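(* Let $m\in\mathbb{N}^*$, $a\in\mathbb{R}$, $I_f\in\mathbb{I}_{a+}$, let $\Omega$ be a nonempty open subset of $\mathbb{R}^m$, let $f:\Omega\times I_f\to\mathbb{R}^m$ be a Carathéodory function, let $q_a\in\Omega$ and $\alpha=(\alpha_1,\dots,\alpha_m)\in(0,1]^m$. Assume that: (i) for any compact $K\subset\Omega$ and any $[c,d]\subset I_f$ there exists $M\ge0$ such that $|f(x,t)|_m\le M$ for any $x\in K$ and for almost every $t\in[c,d]$; (ii) for every $(x,t)\in\Omega\times I_f$ there exist $R>0$, $\delta>0$ and $L\ge0$ such that $\overline{\mathrm{B}}_m(x,R)\subset\Omega$ and $|f(x_2,\tau)-f(x_1,\tau)|_m\le L|x_2-x_1|_m$ for any $x_1,x_2\in\overline{\mathrm{B}}_m(x,R)$ and for almost every $\tau\in[t-\delta,t+\delta]\cap I_f$. Then the Cauchy problem $${}_{\mathrm c}\mathrm{D}^\alpha_{a+}[q](t)=f(q(t),t),\qquad q(a)=q_a$$ has a unique maximal solution $(q,I)$. Moreover $(q,I)$ is the maximal extension of any other local solution of this Cauchy problem (that is, $(q,I)$ is an extension of every local solution).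
   Context: $\mathbb{N}^*$ is the set of positive integers, $|\cdot|_m$ is the Euclidean norm of $\mathbb{R}^m$, $\overline{\mathrm{B}}_m(x,R)$ is the closed ball of $\mathbb{R}^m$ with center $x$ and radius $R$. For $a\in\mathbb{R}$, $\mathbb{I}_{a+}$ denotes the set of intervals $I\subset\mathbb{R}$ with $\{a\}\subsetneq I\subset[a,+\infty)$ (not necessarily compact). $\mathrm{L}^1_{\mathrm{loc}}(I)$ (resp. $\mathrm{AC}_{\mathrm{loc}}(I)$) is the set of functions on $I$ that are integrable (resp. absolutely continuous) on every compact subinterval of $I$; $\mathrm{C}(I)$ is the set of continuous functions. Left fractional operators. Let $I\in\mathbb{I}_{a+}$ and $q\in \mathrm{L}^1_{\mathrm{loc}}(I,\mathbb{R})$. For a real $\alpha>0$, $\mathrm{I}^\alpha_{a+}[q](t):=\int_a^t\frac{1}{\Gamma(\alpha)}(t-\tau)^{\alpha-1}q(\tau)\,d\tau$ (defined for a.e. $t\in I$), and $\mathrm{I}^0_{a+}[q]:=q$; if $\mathrm{I}^\alpha_{a+}[q]$ is a.e. equal to a continuous function, it is identified with it. For $0\le\alpha\le1$, $\mathrm{AC}^\alpha_{a+}(I,\mathbb{R})$ is the set of $q\in \mathrm{L}^1_{\mathrm{loc}}(I,\mathbb{R})$ with $\mathrm{I}^{1-\alpha}_{a+}[q]\in\mathrm{AC}_{\mathrm{loc}}(I,\mathbb{R})$, and then $\mathrm{D}^\alpha_{a+}[q]:=\frac{d}{dt}\mathrm{I}^{1-\alpha}_{a+}[q]$ a.e. on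 $I$. ${}_{\mathrm c}\mathrm{AC}^\alpha_{a+}(I,\mathbb{R})$ is the set of $q\in\mathrm{C}(I,\mathbb{R})$ with $q-q(a)\in\mathrm{AC}^\alpha_{a+}(I,\mathbb{R})$, and then ${}_{\mathrm c}\mathrm{D}^\alpha_{a+}[q]:=\mathrm{D}^\alpha_{a+}[q-q(a)]$. For vector functions $q=(q_i)$ and a multi-order $\alpha=(\alpha_i)$ everything is taken componentwise, the $i$-th component with order $\alpha_i$; ${}_{\mathrm c}\mathrm{AC}^\alpha_{a+}(I,\Omega)$ consists of those functions with values in $\Omega$. A local solution of the Cauchy problem is a couple $(q,I)$ with $I\in\mathbb{I}_{a+}$, $I\subset I_f$, $q\in{}_{\mathrm c}\mathrm{AC}^\alpha_{a+}(I,\Omega)$, $q(a)=q_a$ and ${}_{\mathrm c}\mathrm{D}^\alpha_{a+}[q](t)=f(q(t),t)$ for a.e. $t\in I$. A couple $(q',I')$ is an extension of a local solution $(q,I)$ if $(q',I')$ is a local solution, $I\subset I'$ and $q'=q$ on $I$. A local solution $(q,I)$ is maximal if $I'=I$ for every extension $(q',I')$ of $(q,I)$. *)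

theory Defs
  imports "HOL-Analysis.Analysis"
begin

definition intervals_from :: "real \<Rightarrow> real set set" where
  "intervals_from a = {I. is_interval I \<and> {a} \<subset> I \<and> I \<subseteq> {a..}}"

definition L1_loc :: "real set \<Rightarrow> (real \<Rightarrow> real) set" where
  "L1_loc I = {q. \<forall>c d. {c..d} \<subseteq> I \<longrightarrow> q absolutely_integrable_on {c..d}}"

definition AC_on :: "real set \<Rightarrow> (real \<Rightarrow> real) set" where
  "AC_on S = {F. \<forall>\<epsilon>>0. \<exists>\<delta>>0. \<forall>(n::nat) (x :: nat \<Rightarrow> real) y.
     (\<forall>k<n. x k \<le> y k \<and> {x k..y k} \<subseteq> S) \<longrightarrow>
     disjoint_family_on (\<lambda>k. {x k<..<y k}) {..<n} \<longrightarrow>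
     (\<Sum>k<n. y k - x k) < \<delta> \<longrightarrow> (\<Sum>k<n. \<bar>F (y k) - F (x k)\<bar>) < \<epsilon>}"

definition AC_loc :: "real set \<Rightarrow> (real \<Rightarrow> real) set" where
  "AC_loc I = {F. \<forall>c d. {c..d} \<subseteq> I \<longrightarrow> F \<in> AC_on {c..d}}"

text \<open>The Lebesgue integral is defined for almost every \<open>t\<close> only; where the integrand is not
  integrable, the library value is 0.\<close>

definition RL_integral_raw :: "real \<Rightarrow> real \<Rightarrow> (real \<Rightarrow> real) \<Rightarrow> real \<Rightarrow> real" where
  "RL_integral_raw a \<alpha> q t =
     (if \<alpha> = 0 then q t
      else set_lebesgue_integral lebesgue {a..t}
             (\<lambda>\<tau>. 1 / Gamma \<alpha> * (t - \<tau>) powr (\<alpha> - 1) * q \<tau>))"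

definition continuous_version :: "real set \<Rightarrow> (real \<Rightarrow> real) \<Rightarrow> (real \<Rightarrow> real) \<Rightarrow> bool" where
  "continuous_version I F G \<longleftrightarrow>
     continuous_on I G \<and> (AE t in lebesgue_on I. F t = G t)"

text \<open>The Riemann--Liouville integral is identified with its continuous version on \<open>I\<close> when there is
  one. On a nondegenerate interval \<open>I\<close> this version is unique on \<open>I\<close>; its values outside
  \<open>I\<close> are arbitrary and are never used.\<close>

definition RL_integral :: "real \<Rightarrow> real set \<Rightarrow> real \<Rightarrow> (real \<Rightarrow> real) \<Rightarrow> real \<Rightarrow> real" where
  "RL_integral a I \<alpha> q =
     (if \<exists>G. continuous_version I (RL_integral_raw a \<alpha> q) G
      then SOME G. continuous_version I (RL_integral_raw a \<alpha> q) G
      else RL_integral_raw a \<alpha> q)"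

definition RL_AC :: "real \<Rightarrow> real set \<Rightarrow> real \<Rightarrow> (real \<Rightarrow> real) set" where
  "RL_AC a I \<alpha> = {q \<in> L1_loc I. RL_integral a I (1 - \<alpha>) q \<in> AC_loc I}"

text \<open>The fractional derivatives exist almost everywhere only, so they are stated as relations:
  the derivative exists at \<open>t\<close> and has the given value. The derivative is taken within \<open>I\<close>
  because functions are only relevant on \<open>I\<close>.\<close>

definition has_RL_derivative ::
    "real \<Rightarrow> real set \<Rightarrow> real \<Rightarrow> (real \<Rightarrow> real) \<Rightarrow> real \<Rightarrow> real \<Rightarrow> bool" where
  "has_RL_derivative a I \<alpha> q v t \<longleftrightarrow>
     (RL_integral a I (1 - \<alpha>) q has_real_derivative v) (at t within I)"

definition Caputo_AC ::
    "real \<Rightarrow> real set \<Rightarrow> real ^ 'm \<Rightarrow> (real ^ 'm) set \<Rightarrow> (real \<Rightarrow> real ^ 'm) set" where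
  "Caputo_AC a I \<alpha> \<Omega> =
     {q. continuous_on I q \<and> q ` I \<subseteq> \<Omega> \<and>
         (\<forall>i. (\<lambda>s. q s $ i - q a $ i) \<in> RL_AC a I (\<alpha> $ i))}"

definition has_Caputo_derivative ::
    "real \<Rightarrow> real set \<Rightarrow> real ^ 'm \<Rightarrow> (real \<Rightarrow> real ^ 'm) \<Rightarrow> real ^ 'm \<Rightarrow> real \<Rightarrow> bool" where
  "has_Caputo_derivative a I \<alpha> q v t \<longleftrightarrow>
     (\<forall>i. has_RL_derivative a I (\<alpha> $ i) (\<lambda>s. q s $ i - q a $ i) (v $ i) t)"

definition Caratheodory ::
    "(real ^ 'm) set \<Rightarrow> real set \<Rightarrow> (real ^ 'm \<Rightarrow> real \<Rightarrow> real ^ 'm) \<Rightarrow> bool" where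
  "Caratheodory \<Omega> J f \<longleftrightarrow>
     (\<forall>x\<in>\<Omega>. f x \<in> borel_measurable (lebesgue_on J)) \<and>
     (AE t in lebesgue_on J. continuous_on \<Omega> (\<lambda>x. f x t))"

definition local_solution ::
    "real \<Rightarrow> real set \<Rightarrow> (real ^ 'm) set \<Rightarrow> (real ^ 'm \<Rightarrow> real \<Rightarrow> real ^ 'm) \<Rightarrow> real ^ 'm \<Rightarrow>
     real ^ 'm \<Rightarrow> (real \<Rightarrow> real ^ 'm) \<Rightarrow> real set \<Rightarrow> bool" where
  "local_solution a J \<Omega> f \<alpha> q\<^sub>a q I \<longleftrightarrow>
     I \<in> intervals_from a \<and> I \<subseteq> J \<and> q \<in> Caputo_AC a I \<alpha> \<Omega> \<and> q a = q\<^sub>a \<and>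
     (AE t in lebesgue_on I. has_Caputo_derivative a I \<alpha> q (f (q t) t) t)"

definition is_extension ::
    "real \<Rightarrow> real set \<Rightarrow> (real ^ 'm) set \<Rightarrow> (real ^ 'm \<Rightarrow> real \<Rightarrow> real ^ 'm) \<Rightarrow> real ^ 'm \<Rightarrow>
     real ^ 'm \<Rightarrow> (real \<Rightarrow> real ^ 'm) \<Rightarrow> real set \<Rightarrow> (real \<Rightarrow> real ^ 'm) \<Rightarrow> real set \<Rightarrow> bool" where
  "is_extension a J \<Omega> f \<alpha> q\<^sub>a q' I' q I \<longleftrightarrow>
     local_solution a J \<Omega> f \<alpha> q\<^sub>a q' I' \<and> I \<subseteq> I' \<and> (\<forall>t\<in>I. q' t = q t)"

definition maximal_solution ::
    "real \<Rightarrow> real set \<Rightarrow> (real ^ 'm) set \<Rightarrow> (real ^ 'm \<Rightarrow> real \<Rightarrow> real ^ 'm) \<Rightarrow> real ^ 'm \<Rightarrow>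
     real ^ 'm \<Rightarrow> (real \<Rightarrow> real ^ 'm) \<Rightarrow> real set \<Rightarrow> bool" where
  "maximal_solution a J \<Omega> f \<alpha> q\<^sub>a q I \<longleftrightarrow>
     local_solution a J \<Omega> f \<alpha> q\<^sub>a q I \<and>
     (\<forall>q' I'. is_extension a J \<Omega> f \<alpha> q\<^sub>a q' I' q I \<longrightarrow> I' = I)"

end

theory Submission
  imports Defs
begin

text \<open>For a continuous \<open>q\<close> the right-hand side \<open>f(q(t), t)\<close> is measurable and locally bounded, so the
  Cauchy problem is equivalent to the integral equation \<open>q = q\<^sub>a + I\<^sup>\<alpha> f(q, \<cdot>)\<close>. This rests on
  \<open>I\<^sup>1\<^sup>-\<^sup>\<alpha> I\<^sup>\<alpha> = I\<^sup>1\<close> (Fubini and the Beta integral), Lebesgue differentiation, and the fact that an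
  absolutely continuous function with a.e. vanishing derivative is constant.

  On a short interval \<open>[T, T + h]\<close> the kernel of \<open>I\<^sup>\<alpha>\<close> has small mass, so the integral operator is a
  contraction there: this gives a solution near \<open>a\<close> by Banach's theorem, and it gives uniqueness by
  looking at the first point \<open>T\<close> where two solutions separate. Any two solutions then agree on their
  common interval, and the union of all local solutions is a local solution. It is the greatest one,
  so no continuation argument is needed.\<close>

section \<open>Lebesgue differentiation and absolutely continuous functions\<close>

text \<open>The obstacle is memory: \<open>I^\<alpha>\<close> at t involves the whole past [a, t],
  so for \<alpha> < 1 a solution cannot simply be restarted at a later time. Past the point where
  two solutions separate, however, only the difference of their right-hand sides matters; it
  vanishes on the common past, and the kernel mass that remains is that of a short interval.
  Causality likewise makes the integral equation hold on a union of intervals as soon as it holds on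
  each of them.

  A second obstacle is the null sets. The bounds on f hold for almost every t with an exceptional
  set that depends on x, whereas q(t) runs through uncountably many x. Continuity of f in x and a
  countable dense set of x give one null set for all.

  Finally, Fubini is applied to Borel functions, while f(q(t), t) is only Lebesgue measurable and
  bounded almost everywhere. It is replaced by a Borel version that is bounded everywhere, and the
  results are carried back through almost everywhere equality.\<close>

text \<open>With the tag x at one end of the interval between x and y, the quantity F y - F x - f x
  * (y - x) is, up to sign, the deviation in Henstock's lemma. A bad point thus spans intervals of
  large deviation at arbitrarily small scale; Vitali selects disjoint ones whose fivefold
  enlargements still cover, and Henstock's lemma bounds their total length.\<close>

lemma negligible_large_increment_deviation:
  fixes f :: "real \<Rightarrow> real" and a b \<epsilon> :: real
  assumes int: "f integrable_on {a..b}" and "\<epsilon> > 0"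
  defines "F \<equiv> \<lambda>t. integral {a..t} f"
  shows "negligible {x\<in>{a..b}. \<forall>d>0. \<exists>y\<in>{a..b}. \<bar>y - x\<bar> < d \<and>
           \<epsilon> * \<bar>y - x\<bar> < \<bar>F y - F x - f x * (y - x)\<bar>}" (is "negligible ?E")
  unfolding negligible_outer_le
proof (intro allI impI)
  fix e :: real assume "e > 0"
  \<comment> \<open>The 5 is the enlargement factor of the Vitali covering; \<epsilon> converts
    deviation into length.\<close>
  define \<eta> where "\<eta> = e * \<epsilon> / 5"
  have "\<eta> > 0" using \<open>e > 0\<close> \<open>\<epsilon> > 0\<close> by (simp add: \<eta>_def)
  have intc: "f integrable_on cbox a b" using int by simp
  obtain \<gamma> where "gauge \<gamma>" and \<gamma>: "\<And>p. \<lbrakk>p tagged_partial_division_of (cbox a b); \<gamma> fine p\<rbrakk> \<Longrightarrow>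
             sum (\<lambda>(x,k). norm(measure lborel k *\<^sub>R f x - integral k f)) p < \<eta>"
    using Henstock_lemma[OF intc \<open>\<eta> > 0\<close>] by blast
  \<comment> \<open>A pair keeps the tag x apart from the other end point y, which may lie on either
    side; fineness is measured at x. Below, c and r present the interval as a ball.\<close>
  define K where "K = {(x,y). x \<in> {a..b} \<and> y \<in> {a..b} \<and> y \<noteq> x \<and> {min x y..max x y} \<subseteq> \<gamma> x \<and>
           \<epsilon> * \<bar>y - x\<bar> < \<bar>F y - F x - f x * (y - x)\<bar>}"
  define c where "c = (\<lambda>(x::real,y::real). (x + y) / 2)"
  define r where "r = (\<lambda>(x::real,y::real). \<bar>y - x\<bar> / 2)"
  have cb: "cball (c (x,y)) (r (x,y)) = {min x y..max x y}" for x y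
    by (cases "x \<le> y") (simp_all add: c_def r_def cball_eq_atLeastAtMost field_simps)
  have cov: "?E \<subseteq> (\<Union>i\<in>K. cball (c i) (r i))"
  proof
    fix x assume x: "x \<in> ?E"
    then have xab: "x \<in> {a..b}" by simp
    obtain d where d: "d > 0" "ball x d \<subseteq> \<gamma> x"
      using \<open>gauge \<gamma>\<close> unfolding gauge_def by (meson openE)
    obtain y where y: "y \<in> {a..b}" "\<bar>y - x\<bar> < d" "\<epsilon> * \<bar>y - x\<bar> < \<bar>F y - F x - f x * (y - x)\<bar>"
      using x d(1) by blast
    have "{min x y..max x y} \<subseteq> ball x d" using y(2) by (auto simp: dist_real_def min_def max_def)
    moreover have "y \<noteq> x" using y(3) by auto
    moreover have "{min x y..max x y} \<subseteq> \<gamma> x" using calculation(1) d(2) by (rule order_trans)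
    ultimately have "(x,y) \<in> K" using y xab by (simp add: K_def)
    moreover have "x \<in> cball (c (x,y)) (r (x,y))" unfolding cb by auto
    ultimately show "x \<in> (\<Union>i\<in>K. cball (c i) (r i))" by blast
  qed
  have rK: "0 < r i \<and> r i \<le> b - a" if "i \<in> K" for i
    using that by (auto simp: K_def r_def split: prod.splits)
  obtain C where C: "countable C" "C \<subseteq> K"
     "pairwise (\<lambda>i j. disjnt (cball (c i) (r i)) (cball (c j) (r j))) C"
     "?E \<subseteq> (\<Union>i\<in>C. cball (c i) (5 * r i))"
    by (rule Vitali_covering_lemma_cballs[OF cov rK])
  \<comment> \<open>Henstock's lemma speaks of finite families only; a bound uniform over the finite
    subfamilies passes to the countable one.\<close>
  have fin: "measure lebesgue (\<Union>i\<in>D. cball (c i) (5 * r i)) \<le> e" if D: "D \<subseteq> C" "finite D" for D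
  proof -
    define h where "h = (\<lambda>i. (fst i, cball (c i) (r i)))"
    have dis: "cball (c i) (r i) \<inter> cball (c j) (r j) = {}" if "i \<in> D" "j \<in> D" "i \<noteq> j" for i j
      using that D C(3) unfolding pairwise_def disjnt_def by blast
    have ne: "cball (c i) (r i) \<noteq> {}" if "i \<in> D" for i
      using that D C(2) rK by fastforce
    have inj: "inj_on h D"
      using dis ne unfolding inj_on_def h_def by (metis Int_absorb prod.inject)
    have hD: "i \<in> K" if "i \<in> D" for i using that D C(2) by auto
    have tp: "h ` D tagged_partial_division_of (cbox a b)"
      unfolding tagged_partial_division_of_def
    proof (intro conjI allI impI)
      show "finite (h ` D)" using D by simp
    next
      fix x k assume "(x,k) \<in> h ` D"
      then obtain y where xy: "(x,y) \<in> D" "k = {min x y..max x y}" by (auto simp: h_def cb)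
      show "x \<in> k" using xy by auto
      show "k \<subseteq> cbox a b" using hD[OF xy(1)] xy(2) by (auto simp: K_def)
      show "\<exists>a b. k = cbox a b" using xy(2) by (metis box_real(2))
    next
      fix x1 k1 x2 k2 assume A: "(x1,k1) \<in> h ` D \<and> (x2,k2) \<in> h ` D \<and> (x1,k1) \<noteq> (x2,k2)"
      then obtain i j where "i \<in> D" "j \<in> D" "(x1,k1) = h i" "(x2,k2) = h j" by blast
      then have "k1 \<inter> k2 = {}" using dis[of i j] A by (auto simp: h_def)
      then show "interior k1 \<inter> interior k2 = {}" using interior_subset by blast
    qed
    have fn: "\<gamma> fine (h ` D)"
    proof (rule fineI)
      fix x k assume "(x,k) \<in> h ` D"
      then obtain y where xy: "(x,y) \<in> D" "k = {min x y..max x y}" by (auto simp: h_def cb)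
      show "k \<subseteq> \<gamma> x" using hD[OF xy(1)] xy(2) by (auto simp: K_def)
    qed
    have dev: "\<epsilon> * (2 * r i) \<le> (\<lambda>(x,k). norm(measure lborel k *\<^sub>R f x - integral k f)) (h i)" if "i \<in> D" for i
    proof -
      obtain x y where i: "i = (x,y)" by force
      have xy: "x \<in> {a..b}" "y \<in> {a..b}" "\<epsilon> * \<bar>y - x\<bar> < \<bar>F y - F x - f x * (y - x)\<bar>"
        using hD[OF that] i by (auto simp: K_def)
      have comb: "integral {u..v} f = F v - F u" if "u \<in> {a..b}" "v \<in> {a..b}" "u \<le> v" for u v
        using Henstock_Kurzweil_Integration.integral_combine[of a u v f]
          integrable_on_subinterval[OF int, of a v] that by (auto simp: F_def)
      have "\<bar>F y - F x - f x * (y - x)\<bar> = \<bar>measure lborel {min x y..max x y} * f x - integral {min x y..max x y} f\<bar>"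
        using comb[of x y] comb[of y x] xy(1,2)
        by (cases "x \<le> y") (simp_all add: abs_minus_commute mult.commute, argo)
      then have "\<epsilon> * \<bar>y - x\<bar> \<le> \<bar>measure lborel {min x y..max x y} * f x - integral {min x y..max x y} f\<bar>"
        using xy(3) by linarith
      moreover have "2 * r i = \<bar>y - x\<bar>" by (simp add: r_def i)
      ultimately show ?thesis by (simp only: h_def i cb prod.case fst_conv real_norm_def real_scaleR_def)
    qed
    have "(\<Sum>i\<in>D. \<epsilon> * (2 * r i)) \<le> (\<Sum>i\<in>D. (\<lambda>(x,k). norm(measure lborel k *\<^sub>R f x - integral k f)) (h i))"
      by (rule sum_mono) (rule dev)
    also have "\<dots> = sum (\<lambda>(x,k). norm(measure lborel k *\<^sub>R f x - integral k f)) (h ` D)"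
      by (simp only: sum.reindex[OF inj] o_def)
    also have "\<dots> < \<eta>" using \<gamma>[OF tp fn] .
    finally have s: "\<epsilon> * (\<Sum>i\<in>D. 2 * r i) < \<eta>" by (simp add: sum_distrib_left)
    have "measure lebesgue (\<Union>i\<in>D. cball (c i) (5 * r i)) \<le> (\<Sum>i\<in>D. measure lebesgue (cball (c i) (5 * r i)))"
      using D by (intro measure_UNION_le) auto
    also have "\<dots> = (\<Sum>i\<in>D. 5 * (2 * r i))"
      using hD rK by (intro sum.cong refl) (fastforce simp: cball_eq_atLeastAtMost less_imp_le)
    also have "\<dots> = 5 * (\<Sum>i\<in>D. 2 * r i)" by (simp only: sum_distrib_left)
    also have "\<dots> \<le> e" using s \<open>\<epsilon> > 0\<close> by (simp add: \<eta>_def field_simps)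
    finally show ?thesis .
  qed
  let ?T = "\<Union>i\<in>C. cball (c i) (5 * r i)"
  have "?T \<in> lmeasurable"
    by (rule fmeasurable_UN_bound[OF C(1) _ fin]) auto
  moreover have "measure lebesgue ?T \<le> e"
    by (rule measure_UN_bound[OF C(1) _ fin]) auto
  ultimately show "\<exists>T. ?E \<subseteq> T \<and> T \<in> lmeasurable \<and> measure lebesgue T \<le> e"
    using C(4) by blast
qed

text \<open>A point where the derivative fails violates the tolerance 1/(n+1) for some n, so a
  countable union of negligible sets contains all such points.\<close>

lemma Lebesgue_differentiation_interval:
  fixes f :: "real \<Rightarrow> real"
  assumes int: "f integrable_on {a..b}"
  shows "\<exists>N. negligible N \<and>
    (\<forall>t\<in>{a..b} - N. ((\<lambda>u. integral {a..u} f) has_real_derivative f t) (at t within {a..b}))"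
proof (intro exI conjI ballI)
  let ?F = "\<lambda>u. integral {a..u} f"
  let ?E = "\<lambda>\<epsilon>. {x\<in>{a..b}. \<forall>d>0. \<exists>y\<in>{a..b}. \<bar>y - x\<bar> < d \<and>
           \<epsilon> * \<bar>y - x\<bar> < \<bar>?F y - ?F x - f x * (y - x)\<bar>}"
  let ?N = "\<Union>n. ?E (1 / real (Suc n))"
  show "negligible ?N"
    by (intro negligible_Union_nat negligible_large_increment_deviation int) auto
  fix t assume t: "t \<in> {a..b} - ?N"
  show "(?F has_real_derivative f t) (at t within {a..b})"
    unfolding has_field_derivative_def has_derivative_within_alt
  proof (intro conjI allI impI)
    show "bounded_linear ((*) (f t))" by (rule bounded_linear_mult_right)
    fix e :: real assume "e > 0"
    obtain n where n: "1 / real (Suc n) < e" using \<open>e > 0\<close> nat_approx_posE by blast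
    have "t \<notin> ?E (1 / real (Suc n))" and "t \<in> {a..b}" using t by blast+
    then have "\<not> (\<forall>d>0. \<exists>y\<in>{a..b}. \<bar>y - t\<bar> < d \<and>
           1 / real (Suc n) * \<bar>y - t\<bar> < \<bar>?F y - ?F t - f t * (y - t)\<bar>)" by blast
    then obtain d where d: "d > 0" "\<And>y. y \<in> {a..b} \<Longrightarrow> \<bar>y - t\<bar> < d \<Longrightarrow>
        \<bar>?F y - ?F t - f t * (y - t)\<bar> \<le> 1 / real (Suc n) * \<bar>y - t\<bar>"
      by (meson not_less)
    have "1 / real (Suc n) * \<bar>y - t\<bar> \<le> e * \<bar>y - t\<bar>" for y
      using n by (intro mult_right_mono) auto
    then show "\<exists>d>0. \<forall>y\<in>{a..b}. norm (y - t) < d \<longrightarrow>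
        norm (?F y - ?F t - f t * (y - t)) \<le> e * norm (y - t)"
      using d unfolding real_norm_def by (meson order_trans)
  qed
qed

section \<open>Absolutely continuous functions with almost everywhere vanishing derivative\<close>

text \<open>The definition numbers the intervals 0, ..., n-1, while tagged divisions are finite sets
  of pairs; a bijection transports the criterion to any finite index set.\<close>

lemma AC_on_finite_family:
  assumes "F \<in> AC_on S" "\<epsilon> > 0"
  shows "\<exists>\<delta>>0. \<forall>(P :: 'i set) x y. finite P \<longrightarrow> (\<forall>i\<in>P. x i \<le> y i \<and> {x i..y i} \<subseteq> S) \<longrightarrow>
      disjoint_family_on (\<lambda>i. {x i<..<y i}) P \<longrightarrow> (\<Sum>i\<in>P. y i - x i) < \<delta> \<longrightarrow>
      (\<Sum>i\<in>P. \<bar>F (y i) - F (x i)\<bar>) < \<epsilon>"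
proof -
  obtain \<delta> where "\<delta> > 0" and \<delta>: "\<And>(n::nat) x y. (\<forall>k<n. x k \<le> y k \<and> {x k..y k} \<subseteq> S) \<Longrightarrow>
     disjoint_family_on (\<lambda>k. {x k<..<y k}) {..<n} \<Longrightarrow>
     (\<Sum>k<n. y k - x k) < \<delta> \<Longrightarrow> (\<Sum>k<n. \<bar>F (y k) - F (x k)\<bar>) < \<epsilon>"
    using assms unfolding AC_on_def by blast
  have "(\<Sum>i\<in>P. \<bar>F (y i) - F (x i)\<bar>) < \<epsilon>"
    if P: "finite P" "\<forall>i\<in>P. x i \<le> y i \<and> {x i..y i} \<subseteq> S"
      "disjoint_family_on (\<lambda>i. {x i<..<y i}) P" "(\<Sum>i\<in>P. y i - x i) < \<delta>" for P :: "'i set" and x y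
  proof -
    obtain h where h: "bij_betw h {..<card P} P"
      using ex_bij_betw_nat_finite[OF P(1)] by (auto simp: atLeast0LessThan)
    have hP: "h k \<in> P" if "k < card P" for k using h that by (auto simp: bij_betw_def)
    have "(\<Sum>k<card P. \<bar>F (y (h k)) - F (x (h k))\<bar>) < \<epsilon>"
    proof (rule \<delta>)
      show "\<forall>k<card P. x (h k) \<le> y (h k) \<and> {x (h k)..y (h k)} \<subseteq> S" using P(2) hP by blast
      show "disjoint_family_on (\<lambda>k. {x (h k)<..<y (h k)}) {..<card P}"
        using P(3) h unfolding disjoint_family_on_def bij_betw_def inj_on_def by (metis hP lessThan_iff)
      show "(\<Sum>k<card P. y (h k) - x (h k)) < \<delta>"
        using sum.reindex_bij_betw[OF h, of "\<lambda>i. y i - x i"] P(4) by simp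
    qed
    then show ?thesis
      using sum.reindex_bij_betw[OF h, of "\<lambda>i. \<bar>F (y i) - F (x i)\<bar>"] by simp
  qed
  with \<open>\<delta> > 0\<close> show ?thesis by blast
qed

text \<open>A fine tagged division splits by its tags. Intervals tagged in N have small total
  length, so absolute continuity controls their increments; at the other tags the derivative 0 makes
  each increment at most \<epsilon> times the length. The increments telescope to F b - F a.\<close>

lemma AC_on_zero_derivative_imp_eq:
  assumes AC: "F \<in> AC_on {a..b}" and "a \<le> b" and N: "negligible N"
    and der: "\<And>t. t \<in> {a..b} - N \<Longrightarrow> (F has_real_derivative 0) (at t within {a..b})"
  shows "F b = F a"
proof -
  have le: "\<bar>F b - F a\<bar> \<le> \<epsilon> * (b - a) + \<epsilon>" if "\<epsilon> > 0" for \<epsilon>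
  proof -
    obtain \<delta> where "\<delta> > 0" and \<delta>: "\<forall>(P :: (real \<times> real set) set) x y. finite P \<longrightarrow>
      (\<forall>i\<in>P. x i \<le> y i \<and> {x i..y i} \<subseteq> {a..b}) \<longrightarrow>
      disjoint_family_on (\<lambda>i. {x i<..<y i}) P \<longrightarrow> (\<Sum>i\<in>P. y i - x i) < \<delta> \<longrightarrow>
      (\<Sum>i\<in>P. \<bar>F (y i) - F (x i)\<bar>) < \<epsilon>"
      using AC_on_finite_family[OF AC \<open>\<epsilon> > 0\<close>] by blast
    have "N \<in> sets lebesgue" using N by (simp add: negligible_imp_sets)
    \<comment> \<open>Outer regularity: since N is null, the open set U itself has measure below
      \<delta>.\<close>
    then obtain U where U: "open U" "N \<subseteq> U" "emeasure lebesgue (U - N) < ennreal \<delta>"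
      by (rule sets_lebesgue_outer_open[OF _ \<open>\<delta> > 0\<close>])
    have emU: "emeasure lebesgue U < ennreal \<delta>"
    proof -
      have "emeasure lebesgue (U - N) = emeasure lebesgue U"
        using U N by (intro emeasure_Diff_null_set) (auto simp: negligible_iff_null_sets)
      then show ?thesis using U by simp
    qed
    have "\<exists>d>0. \<forall>y\<in>{a..b}. \<bar>y - t\<bar> < d \<longrightarrow> \<bar>F y - F t\<bar> \<le> \<epsilon> * \<bar>y - t\<bar>" if "t \<in> {a..b} - N" for t
      using der[OF that] \<open>\<epsilon> > 0\<close> unfolding has_field_derivative_def has_derivative_within_alt by simp
    then obtain d where d: "\<And>t. t \<in> {a..b} - N \<Longrightarrow> d t > 0"
      "\<And>t y. t \<in> {a..b} - N \<Longrightarrow> y \<in> {a..b} \<Longrightarrow> \<bar>y - t\<bar> < d t \<Longrightarrow> \<bar>F y - F t\<bar> \<le> \<epsilon> * \<bar>y - t\<bar>"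
      by metis
    \<comment> \<open>Tags in N force their intervals into U, all other tags force small increments.
      The last case only makes the gauge total, since the tags of a division lie in [a, b].\<close>
    define \<gamma> where "\<gamma> t = (if t \<in> N then U else if t \<in> {a..b} then ball t (d t) else UNIV)" for t
    have "gauge \<gamma>" using U d(1) by (auto simp: gauge_def \<gamma>_def)
    then obtain p where p: "p tagged_division_of {a..b}" "\<gamma> fine p"
      by (rule fine_division_exists_real)
    have fp: "finite p" using p by blast
    have shape: "\<exists>u v. u \<le> v \<and> k = {u..v} \<and> x \<in> {u..v} \<and> {u..v} \<subseteq> {a..b} \<and> k \<subseteq> \<gamma> x" if xk: "(x,k) \<in> p" for x k
    proof -
      obtain u v where uv: "k = cbox u v" using tagged_division_ofD(4)[OF p(1) xk] by blast
      moreover have "x \<in> k" "k \<subseteq> {a..b}" using tagged_division_ofD(2,3)[OF p(1) xk] by auto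
      moreover have "k \<subseteq> \<gamma> x" using p(2) that by (auto simp: fine_def)
      ultimately show ?thesis by (intro exI[of _ u] exI[of _ v]) auto
    qed
    define p1 where "p1 = {i\<in>p. fst i \<in> N}"
    define p2 where "p2 = {i\<in>p. fst i \<notin> N}"
    have pp: "p = p1 \<union> p2" "p1 \<inter> p2 = {}" "finite p1" "finite p2"
      using fp by (auto simp: p1_def p2_def)
    \<comment> \<open>A division stores sets, so end points are recovered as infimum and
      supremum.\<close>
    let ?lo = "\<lambda>i::real \<times> real set. Inf (snd i)" and ?hi = "\<lambda>i::real \<times> real set. Sup (snd i)"
    have lohi: "?lo i \<le> ?hi i \<and> {?lo i..?hi i} \<subseteq> {a..b} \<and> {?lo i..?hi i} = snd i \<and> ?lo i \<le> fst i \<and> fst i \<le> ?hi i \<and> snd i \<subseteq> \<gamma> (fst i)"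
      if "i \<in> p" for i
      using shape[of "fst i" "snd i"] that by (auto simp: cInf_atLeastAtMost cSup_atLeastAtMost)
    have dj: "disjoint_family_on (\<lambda>i. {?lo i<..<?hi i}) p"
      unfolding disjoint_family_on_def
    proof (intro ballI impI)
      fix i j assume ij: "i \<in> p" "j \<in> p" "i \<noteq> j"
      have "interior (snd i) \<inter> interior (snd j) = {}"
        using tagged_division_ofD(5)[OF p(1), of "fst i" "snd i" "fst j" "snd j"] ij by auto
      then show "{?lo i<..<?hi i} \<inter> {?lo j<..<?hi j} = {}"
        using lohi[OF ij(1)] lohi[OF ij(2)] interior_atLeastAtMost_real by metis
    qed
    have s1: "(\<Sum>i\<in>p1. \<bar>F (?hi i) - F (?lo i)\<bar>) < \<epsilon>"
    proof (rule \<delta>[rule_format, OF pp(3)])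
      show "?lo i \<le> ?hi i \<and> {?lo i..?hi i} \<subseteq> {a..b}" if "i \<in> p1" for i
        using lohi[of i] that unfolding p1_def by blast
      show dj1: "disjoint_family_on (\<lambda>i. {?lo i<..<?hi i}) p1"
        using dj by (rule disjoint_family_on_mono[rotated]) (auto simp: p1_def)
      have "(\<Sum>i\<in>p1. ennreal (?hi i - ?lo i)) = (\<Sum>i\<in>p1. emeasure lebesgue {?lo i<..<?hi i})"
      proof (rule sum.cong[OF refl])
        fix i assume "i \<in> p1"
        then show "ennreal (?hi i - ?lo i) = emeasure lebesgue {?lo i<..<?hi i}"
          using lohi[of i] by (simp add: p1_def)
      qed
      also have "\<dots> = emeasure lebesgue (\<Union>i\<in>p1. {?lo i<..<?hi i})"
        by (rule sum_emeasure[OF _ dj1 pp(3)]) auto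
      also have "\<dots> \<le> emeasure lebesgue U"
      proof (rule emeasure_mono)
        show "(\<Union>i\<in>p1. {?lo i<..<?hi i}) \<subseteq> U"
        proof (rule UN_least)
          fix i assume i: "i \<in> p1"
          then have "snd i \<subseteq> U" using lohi[of i] by (simp add: p1_def \<gamma>_def)
          moreover have "{?lo i<..<?hi i} \<subseteq> {?lo i..?hi i}" by auto
          then have "{?lo i<..<?hi i} \<subseteq> snd i" using lohi[of i] i by (simp add: p1_def)
          ultimately show "{?lo i<..<?hi i} \<subseteq> U" by blast
        qed
      qed (use U in auto)
      also have "\<dots> < ennreal \<delta>" by (rule emU)
      finally have "ennreal (\<Sum>i\<in>p1. ?hi i - ?lo i) < ennreal \<delta>"
        using lohi by (subst sum_ennreal[symmetric]) (simp_all add: p1_def)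
      moreover have "0 \<le> (\<Sum>i\<in>p1. ?hi i - ?lo i)"
        using lohi by (intro sum_nonneg) (simp add: p1_def)
      ultimately show "(\<Sum>i\<in>p1. ?hi i - ?lo i) < \<delta>"
        by (simp only: ennreal_less_iff)
    qed
    have t2: "\<bar>F (?hi i) - F (?lo i)\<bar> \<le> \<epsilon> * measure lborel (snd i)" if "i \<in> p2" for i
    proof -
      have ip: "i \<in> p" "fst i \<notin> N" using that by (auto simp: p2_def)
      note L = lohi[OF ip(1)]
      let ?t = "fst i"
      have mem: "?hi i \<in> {?lo i..?hi i}" "?lo i \<in> {?lo i..?hi i}" "?t \<in> {?lo i..?hi i}"
        unfolding atLeastAtMost_iff using L by auto
      then have t: "?t \<in> {a..b} - N" using L ip by blast
      have "snd i \<subseteq> ball ?t (d ?t)" using L t by (simp add: \<gamma>_def)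
      then have "?hi i \<in> ball ?t (d ?t)" "?lo i \<in> ball ?t (d ?t)" using mem L by blast+
      then have "\<bar>?hi i - ?t\<bar> < d ?t" "\<bar>?lo i - ?t\<bar> < d ?t" by (simp_all add: dist_real_def abs_minus_commute)
      moreover have "?lo i \<in> {a..b}" "?hi i \<in> {a..b}" using mem L by blast+
      ultimately have "\<bar>F (?hi i) - F ?t\<bar> \<le> \<epsilon> * \<bar>?hi i - ?t\<bar>" "\<bar>F (?lo i) - F ?t\<bar> \<le> \<epsilon> * \<bar>?lo i - ?t\<bar>"
        using d(2)[OF t] by auto
      then have "\<bar>F (?hi i) - F (?lo i)\<bar> \<le> \<epsilon> * \<bar>?hi i - ?t\<bar> + \<epsilon> * \<bar>?lo i - ?t\<bar>" by linarith
      also have "\<dots> = \<epsilon> * (?hi i - ?lo i)" using L by (simp add: algebra_simps)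
      also have "?hi i - ?lo i = measure lborel (snd i)" using L by (metis content_real)
      finally show ?thesis .
    qed
    have "(\<Sum>i\<in>p2. \<bar>F (?hi i) - F (?lo i)\<bar>) \<le> (\<Sum>i\<in>p2. \<epsilon> * measure lborel (snd i))" by (rule sum_mono) (rule t2)
    also have "\<dots> \<le> (\<Sum>i\<in>p. \<epsilon> * measure lborel (snd i))"
      using \<open>\<epsilon> > 0\<close> fp by (intro sum_mono2) (auto simp: p2_def)
    also have "\<dots> = \<epsilon> * (\<Sum>(x,k)\<in>p. measure lborel k)" by (simp add: sum_distrib_left split_def)
    also have "(\<Sum>(x,k)\<in>p. measure lborel k) = b - a"
      using additive_content_tagged_division[of p a b] p(1) \<open>a \<le> b\<close> by simp
    finally have s2: "(\<Sum>i\<in>p2. \<bar>F (?hi i) - F (?lo i)\<bar>) \<le> \<epsilon> * (b - a)" .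
    have "F b - F a = (\<Sum>i\<in>p. F (?hi i) - F (?lo i))"
      using additive_tagged_division_1[OF \<open>a \<le> b\<close> p(1), of F] by (simp add: split_def)
    then have "\<bar>F b - F a\<bar> \<le> (\<Sum>i\<in>p. \<bar>F (?hi i) - F (?lo i)\<bar>)" by simp
    also have "\<dots> = (\<Sum>i\<in>p1. \<bar>F (?hi i) - F (?lo i)\<bar>) + (\<Sum>i\<in>p2. \<bar>F (?hi i) - F (?lo i)\<bar>)"
      unfolding pp(1) by (rule sum.union_disjoint[OF pp(3,4,2)])
    finally show ?thesis using s1 s2 by linarith
  qed
  have "\<bar>F b - F a\<bar> \<le> 0 + \<epsilon>" if "\<epsilon> > 0" for \<epsilon>
  proof -
    \<comment> \<open>Dividing by b - a + 1 makes the two terms of \<open>le\<close> add up to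
      exactly the prescribed \<epsilon>.\<close>
    have "\<bar>F b - F a\<bar> \<le> \<epsilon> / (b - a + 1) * (b - a) + \<epsilon> / (b - a + 1)"
      using that \<open>a \<le> b\<close> by (intro le) simp
    also have "\<dots> = \<epsilon> / (b - a + 1) * (b - a + 1)" by (simp only: distrib_left mult_1_right)
    also have "\<dots> = \<epsilon>" using \<open>a \<le> b\<close> by simp
    finally show ?thesis by simp
  qed
  then have "\<bar>F b - F a\<bar> \<le> 0" by (rule field_le_epsilon)
  then show ?thesis by simp
qed

section \<open>The Riemann--Liouville kernel\<close>

text \<open>The truncated power of fractional calculus. Its vanishing for s \<le> 0 replaces the
  upper limit t of the integral.\<close>

definition RL_kernel :: "real \<Rightarrow> real \<Rightarrow> real" where
  "RL_kernel \<alpha> s = (if 0 < s then s powr (\<alpha> - 1) / Gamma \<alpha> else 0)"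

text \<open>A convolution over the whole line: the lower limit a is encoded by functions h that
  vanish to the left of a. The Borel measure \<open>lborel\<close> is chosen for the sake of
  Fubini.\<close>

definition RL_conv :: "real \<Rightarrow> (real \<Rightarrow> real) \<Rightarrow> real \<Rightarrow> real" where
  "RL_conv \<alpha> h t = (\<integral>\<tau>. RL_kernel \<alpha> (t - \<tau>) * h \<tau> \<partial>lborel)"

lemma RL_kernel_measurable [measurable]: "RL_kernel \<alpha> \<in> borel_measurable borel"
  unfolding RL_kernel_def by measurable

lemma RL_kernel_nonneg: "0 < \<alpha> \<Longrightarrow> 0 \<le> RL_kernel \<alpha> s"
  by (simp add: RL_kernel_def Gamma_real_nonneg)

lemma RL_kernel_antimono:
  assumes "0 < \<alpha>" "\<alpha> \<le> 1" "0 < s" "s \<le> s'"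
  shows "RL_kernel \<alpha> s' \<le> RL_kernel \<alpha> s"
  using assms powr_mono2'[of "\<alpha> - 1" s s']
  by (simp add: RL_kernel_def divide_right_mono Gamma_real_nonneg)

text \<open>The power and Beta integrals are available as gauge integrals; nonnegativity turns them
  into Lebesgue integrals.\<close>

lemma has_bochner_integral_lborel_of_has_integral:
  fixes f :: "real \<Rightarrow> real"
  assumes [measurable]: "f \<in> borel_measurable borel" "S \<in> sets borel"
    and "\<And>x. x \<in> S \<Longrightarrow> 0 \<le> f x" "(f has_integral I) S"
  shows "has_bochner_integral lborel (\<lambda>x. f x * indicator S x) I"
proof (rule has_bochner_integral_nn_integral)
  show "AE x in lborel. 0 \<le> f x * indicator S x" using assms(3) by (auto simp: indicator_def)
  show "0 \<le> I" using assms(3,4) by (rule has_integral_nonneg[rotated])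
  show "(\<integral>\<^sup>+x. ennreal (f x * indicator S x) \<partial>lborel) = ennreal I"
    using nn_integral_has_integral_lebesgue[OF assms(3,4)] by (simp add: mult.commute)
qed simp

text \<open>This is the kernel mass on [c, t] that all later estimates use; it tends to 0 with t -
  c, which is where contraction on short intervals comes from.\<close>

lemma has_bochner_integral_RL_kernel:
  assumes "0 < \<alpha>" "c \<le> t"
  shows "has_bochner_integral lborel (\<lambda>\<tau>. RL_kernel \<alpha> (t - \<tau>) * indicator {c..} \<tau>) ((t - c) powr \<alpha> / Gamma (\<alpha> + 1))"
proof -
  have "((\<lambda>s. s powr (\<alpha> - 1)) has_integral ((t - c) powr (\<alpha> - 1 + 1) / (\<alpha> - 1 + 1))) {0..t - c}"
    using assms by (intro has_integral_powr_from_0) auto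
  then have "has_bochner_integral lborel (\<lambda>s. s powr (\<alpha> - 1) * indicator {0..t - c} s) ((t - c) powr \<alpha> / \<alpha>)"
    by (intro has_bochner_integral_lborel_of_has_integral) auto
  then have "has_bochner_integral lborel (\<lambda>s. s powr (\<alpha> - 1) * indicator {0..t - c} s / Gamma \<alpha>) ((t - c) powr \<alpha> / \<alpha> / Gamma \<alpha>)"
    by (rule has_bochner_integral_divide_zero)
  also have "(\<lambda>s. s powr (\<alpha> - 1) * indicator {0..t - c} s / Gamma \<alpha>) = (\<lambda>s. RL_kernel \<alpha> s * indicator {..t - c} s)"
    by (auto simp: RL_kernel_def indicator_def fun_eq_iff)
  also have "(t - c) powr \<alpha> / \<alpha> / Gamma \<alpha> = (t - c) powr \<alpha> / Gamma (\<alpha> + 1)"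
    using assms Gamma_plus1[of \<alpha>] by (simp add: nonpos_Ints_def)
  finally have "has_bochner_integral lborel (\<lambda>\<tau>. RL_kernel \<alpha> (t + (-1) * \<tau>) * indicator {..t - c} (t + (-1) * \<tau>))
     ((t - c) powr \<alpha> / Gamma (\<alpha> + 1) /\<^sub>R \<bar>-1\<bar>)"
    by (subst (asm) lborel_has_bochner_integral_real_affine_iff[of "-1" _ _ t]) auto
  then show ?thesis
    by (simp add: indicator_def atLeast_def atMost_def cong: if_cong)
qed

text \<open>Since h vanishes before c, only the kernel mass on [c, t] enters. Later c is a when an
  integral is bounded, and the point up to which two solutions agree when a difference is
  bounded.\<close>

lemma
  assumes "0 < \<alpha>" "c \<le> t" and [measurable]: "h \<in> borel_measurable borel"
    and M: "\<And>\<tau>. \<tau> < t \<Longrightarrow> \<bar>h \<tau>\<bar> \<le> M" and z: "\<And>\<tau>. \<tau> < c \<Longrightarrow> h \<tau> = 0"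
  shows integrable_RL_conv: "integrable lborel (\<lambda>\<tau>. RL_kernel \<alpha> (t - \<tau>) * h \<tau>)"
    and abs_RL_conv_le: "\<bar>RL_conv \<alpha> h t\<bar> \<le> M * ((t - c) powr \<alpha> / Gamma (\<alpha> + 1))"
proof -
  have b: "\<bar>RL_kernel \<alpha> (t - \<tau>) * h \<tau>\<bar> \<le> M * (RL_kernel \<alpha> (t - \<tau>) * indicator {c..} \<tau>)" for \<tau>
  proof (cases "c \<le> \<tau> \<and> \<tau> < t")
    case True
    then have "RL_kernel \<alpha> (t - \<tau>) * \<bar>h \<tau>\<bar> \<le> RL_kernel \<alpha> (t - \<tau>) * M"
      using M[of \<tau>] RL_kernel_nonneg[OF assms(1)] by (intro mult_left_mono) auto
    then show ?thesis using True RL_kernel_nonneg[OF assms(1), of "t - \<tau>"] by (simp add: abs_mult mult.commute)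
  next
    case False then show ?thesis using z[of \<tau>] by (auto simp: RL_kernel_def not_less)
  qed
  note K = has_bochner_integral_RL_kernel[OF assms(1,2)]
  have i: "integrable lborel (\<lambda>\<tau>. M * (RL_kernel \<alpha> (t - \<tau>) * indicator {c..} \<tau>))"
    using K by (intro integrable_mult_right) (auto simp: has_bochner_integral_iff)
  show j: "integrable lborel (\<lambda>\<tau>. RL_kernel \<alpha> (t - \<tau>) * h \<tau>)"
    by (rule Bochner_Integration.integrable_bound[OF i])
      (use b in \<open>auto intro!: AE_I2 intro: order_trans[OF _ abs_ge_self]\<close>)
  have "\<bar>RL_conv \<alpha> h t\<bar> \<le> (\<integral>\<tau>. \<bar>RL_kernel \<alpha> (t - \<tau>) * h \<tau>\<bar> \<partial>lborel)"
    unfolding RL_conv_def using integral_norm_bound[of lborel "\<lambda>\<tau>. RL_kernel \<alpha> (t - \<tau>) * h \<tau>"] by simp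
  also have "\<dots> \<le> (\<integral>\<tau>. M * (RL_kernel \<alpha> (t - \<tau>) * indicator {c..} \<tau>) \<partial>lborel)"
    using i j b by (intro integral_mono) auto
  also have "\<dots> = M * ((t - c) powr \<alpha> / Gamma (\<alpha> + 1))"
    using K by (simp add: has_bochner_integral_iff)
  finally show "\<bar>RL_conv \<alpha> h t\<bar> \<le> M * ((t - c) powr \<alpha> / Gamma (\<alpha> + 1))" .
qed

text \<open>For \<alpha> \<le> 1 the kernel decreases, so with A the kernel mass the two kernels
  differ on [a, t] by A(t - a) - A(t' - a) + A(t' - t) in the mean, and the new piece [t, t'] adds
  A(t' - t). The first two terms together are at most 0, whence the factor 2.\<close>

lemma RL_conv_Hoelder:
  assumes "0 < \<alpha>" "\<alpha> \<le> 1" "a \<le> t" "t \<le> t'" and [measurable]: "h \<in> borel_measurable borel"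
    and M: "\<And>\<tau>. \<bar>h \<tau>\<bar> \<le> M" and z: "\<And>\<tau>. \<tau> < a \<Longrightarrow> h \<tau> = 0"
  shows "\<bar>RL_conv \<alpha> h t' - RL_conv \<alpha> h t\<bar> \<le> 2 * M / Gamma (\<alpha> + 1) * (t' - t) powr \<alpha>"
proof -
  have "0 \<le> M" using M[of 0] by linarith
  let ?k = "RL_kernel \<alpha>"
  \<comment> \<open>For \<tau> \<ge> t the kernel at t - \<tau> is 0 and the doubled term changes
    the sign of the other one. So to the right of a, B is M times the absolute difference of the
    kernels.\<close>
  define B where "B \<tau> = M * (?k (t - \<tau>) * indicator {a..} \<tau> - ?k (t' - \<tau>) * indicator {a..} \<tau> + 2 * (?k (t' - \<tau>) * indicator {t..} \<tau>))" for \<tau>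
  let ?A = "\<lambda>s. s powr \<alpha> / Gamma (\<alpha> + 1)"
  have B: "has_bochner_integral lborel B (M * (?A (t - a) - ?A (t' - a) + 2 * ?A (t' - t)))"
    unfolding B_def using assms
    by (intro has_bochner_integral_mult_right has_bochner_integral_add has_bochner_integral_diff
        has_bochner_integral_RL_kernel) auto
  have b: "\<bar>?k (t' - \<tau>) * h \<tau> - ?k (t - \<tau>) * h \<tau>\<bar> \<le> B \<tau>" for \<tau>
  proof (cases "a \<le> \<tau>")
    case True
    have "\<bar>?k (t' - \<tau>) - ?k (t - \<tau>)\<bar> \<le> ?k (t - \<tau>) - ?k (t' - \<tau>) + 2 * (?k (t' - \<tau>) * indicator {t..} \<tau>)"
    proof (cases "\<tau> < t")
      case True
      then show ?thesis using RL_kernel_antimono[OF assms(1,2), of "t - \<tau>" "t' - \<tau>"] assms by simp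
    next
      case False
      then show ?thesis using RL_kernel_nonneg[OF assms(1), of "t' - \<tau>"] by (simp add: RL_kernel_def[of _ "t - \<tau>"])
    qed
    then have "\<bar>?k (t' - \<tau>) - ?k (t - \<tau>)\<bar> * \<bar>h \<tau>\<bar> \<le> (?k (t - \<tau>) - ?k (t' - \<tau>) + 2 * (?k (t' - \<tau>) * indicator {t..} \<tau>)) * M"
      using M \<open>0 \<le> M\<close> by (intro mult_mono) auto
    moreover have "?k (t' - \<tau>) * h \<tau> - ?k (t - \<tau>) * h \<tau> = (?k (t' - \<tau>) - ?k (t - \<tau>)) * h \<tau>"
      by (simp add: left_diff_distrib)
    ultimately show ?thesis using True by (simp add: B_def abs_mult mult.commute)
  next
    case False
    then show ?thesis using z[of \<tau>] assms by (simp add: B_def)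
  qed
  have i1: "integrable lborel (\<lambda>\<tau>. ?k (t' - \<tau>) * h \<tau>)" "integrable lborel (\<lambda>\<tau>. ?k (t - \<tau>) * h \<tau>)"
    using assms by (auto intro!: integrable_RL_conv[where c=a and M=M])
  have "\<bar>RL_conv \<alpha> h t' - RL_conv \<alpha> h t\<bar> = \<bar>\<integral>\<tau>. ?k (t' - \<tau>) * h \<tau> - ?k (t - \<tau>) * h \<tau> \<partial>lborel\<bar>"
    unfolding RL_conv_def using i1 by simp
  also have "\<dots> \<le> (\<integral>\<tau>. \<bar>?k (t' - \<tau>) * h \<tau> - ?k (t - \<tau>) * h \<tau>\<bar> \<partial>lborel)"
    using integral_norm_bound[of lborel "\<lambda>\<tau>. ?k (t' - \<tau>) * h \<tau> - ?k (t - \<tau>) * h \<tau>"] by simp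
  also have "\<dots> \<le> integral\<^sup>L lborel B"
    using i1 b B by (intro integral_mono) (auto simp: has_bochner_integral_iff)
  also have "\<dots> = M * (?A (t - a) - ?A (t' - a) + 2 * ?A (t' - t))"
    using B by (simp add: has_bochner_integral_iff)
  also have "\<dots> \<le> M * (2 * ?A (t' - t))"
  proof (intro mult_left_mono)
    have "?A (t - a) \<le> ?A (t' - a)"
      using assms by (intro divide_right_mono powr_mono2 Gamma_real_nonneg) auto
    then show "?A (t - a) - ?A (t' - a) + 2 * ?A (t' - t) \<le> 2 * ?A (t' - t)" by simp
  qed fact
  finally show ?thesis by (simp add: mult_ac)
qed

lemma continuous_on_RL_conv:
  assumes "0 < \<alpha>" "\<alpha> \<le> 1" and [measurable]: "h \<in> borel_measurable borel"
    and M: "\<And>\<tau>. \<bar>h \<tau>\<bar> \<le> M" and z: "\<And>\<tau>. \<tau> < a \<Longrightarrow> h \<tau> = 0"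
  shows "continuous_on {a..} (RL_conv \<alpha> h)"
  unfolding continuous_on_def
proof
  fix t assume t: "t \<in> {a..}"
  let ?C = "2 * M / Gamma (\<alpha> + 1)"
  have H: "\<bar>RL_conv \<alpha> h v - RL_conv \<alpha> h w\<bar> \<le> ?C * (v - w) powr \<alpha>" if "a \<le> w" "w \<le> v" for v w
    by (rule RL_conv_Hoelder[OF assms(1,2) that assms(3) M z])
  have le: "\<bar>RL_conv \<alpha> h u - RL_conv \<alpha> h t\<bar> \<le> ?C * \<bar>u - t\<bar> powr \<alpha>" if "u \<in> {a..}" for u
    using H[of t u] H[of u t] t that by (cases "t \<le> u") (auto simp: abs_minus_commute)
  have "((\<lambda>u. u - t) \<longlongrightarrow> t - t) (at t within {a..})"
    by (rule tendsto_diff[OF tendsto_ident_at tendsto_const])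
  then have "((\<lambda>u. \<bar>u - t\<bar>) \<longlongrightarrow> 0) (at t within {a..})"
    using tendsto_rabs_zero by simp
  then have "((\<lambda>u. \<bar>u - t\<bar> powr \<alpha>) \<longlongrightarrow> 0 powr \<alpha>) (at t within {a..})"
    by (rule tendsto_powr'[OF _ tendsto_const]) (use assms(1) in simp)
  from tendsto_mult_left[OF this, of ?C]
  have lim: "((\<lambda>u. ?C * \<bar>u - t\<bar> powr \<alpha>) \<longlongrightarrow> 0) (at t within {a..})" by simp
  have "\<forall>\<^sub>F u in at t within {a..}. norm (RL_conv \<alpha> h u - RL_conv \<alpha> h t) \<le> ?C * \<bar>u - t\<bar> powr \<alpha>"
    unfolding eventually_at real_norm_def using le zero_less_one by metis
  from Lim_null_comparison[OF this lim]
  have "((\<lambda>u. RL_conv \<alpha> h u - RL_conv \<alpha> h t) \<longlongrightarrow> 0) (at t within {a..})" .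
  then show "(RL_conv \<alpha> h \<longlongrightarrow> RL_conv \<alpha> h t) (at t within {a..})"
    by (simp add: LIM_zero_iff)
qed

section \<open>Composition of kernels of complementary orders\<close>

text \<open>The substitution u = (s - \<tau>) / (t - \<tau>) reduces this to Beta(\<alpha>, 1 -
  \<alpha>) = Gamma(\<alpha>) Gamma(1 - \<alpha>). The value 1 for all \<tau> < t is the kernel of
  ordinary integration.\<close>

lemma has_bochner_integral_RL_kernel_kernel:
  assumes "0 < \<alpha>" "\<alpha> < 1" "\<tau> < t"
  shows "has_bochner_integral lborel (\<lambda>s. RL_kernel (1 - \<alpha>) (t - s) * RL_kernel \<alpha> (s - \<tau>)) 1"
proof -
  let ?G = "Gamma \<alpha> * Gamma (1 - \<alpha>)"
  have G: "?G > 0" using assms by (simp add: Gamma_real_pos)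
  have "Beta \<alpha> (1 - \<alpha>) = ?G" using assms by (simp add: Beta_def)
  then have "((\<lambda>u. u powr (\<alpha> - 1) * (1 - u) powr (1 - \<alpha> - 1)) has_integral ?G) {0..1}"
    using has_integral_Beta_real[of \<alpha> "1 - \<alpha>"] assms by simp
  then have "has_bochner_integral lborel (\<lambda>u. u powr (\<alpha> - 1) * (1 - u) powr (1 - \<alpha> - 1) * indicator {0..1} u) ?G"
    by (intro has_bochner_integral_lborel_of_has_integral) auto
  then have "has_bochner_integral lborel (\<lambda>u. u powr (\<alpha> - 1) * (1 - u) powr (1 - \<alpha> - 1) * indicator {0..1} u / ?G) (?G / ?G)"
    by (rule has_bochner_integral_divide_zero)
  also have "(\<lambda>u. u powr (\<alpha> - 1) * (1 - u) powr (1 - \<alpha> - 1) * indicator {0..1} u / ?G) =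
     (\<lambda>u. RL_kernel (1 - \<alpha>) (1 - u) * RL_kernel \<alpha> u)"
    by (auto simp: RL_kernel_def indicator_def fun_eq_iff mult.commute)
  also have "?G / ?G = 1" by (rule divide_self) (use G in linarith)
  finally have *: "has_bochner_integral lborel (\<lambda>u. RL_kernel (1 - \<alpha>) (1 - u) * RL_kernel \<alpha> u) 1" .
  let ?c = "1 / (t - \<tau>)" and ?d = "- \<tau> / (t - \<tau>)"
  have "has_bochner_integral lborel (\<lambda>s. RL_kernel (1 - \<alpha>) (1 - (?d + ?c * s)) * RL_kernel \<alpha> (?d + ?c * s)) (1 /\<^sub>R \<bar>?c\<bar>)"
    using * assms by (subst (asm) lborel_has_bochner_integral_real_affine_iff[of ?c _ _ ?d]) auto
  then have "has_bochner_integral lborel (\<lambda>s. (RL_kernel (1 - \<alpha>) (1 - (?d + ?c * s)) * RL_kernel \<alpha> (?d + ?c * s)) / (t - \<tau>)) (1 /\<^sub>R \<bar>?c\<bar> / (t - \<tau>))"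
    by (rule has_bochner_integral_divide_zero)
  also have "1 /\<^sub>R \<bar>?c\<bar> / (t - \<tau>) = 1" using assms by simp
  also have "(\<lambda>s. (RL_kernel (1 - \<alpha>) (1 - (?d + ?c * s)) * RL_kernel \<alpha> (?d + ?c * s)) / (t - \<tau>)) =
     (\<lambda>s. RL_kernel (1 - \<alpha>) (t - s) * RL_kernel \<alpha> (s - \<tau>))"
  proof
    fix s
    have e2: "?d + ?c * s = (s - \<tau>) / (t - \<tau>)" by (simp add: diff_divide_distrib)
    have "1 - (s - \<tau>) / (t - \<tau>) = ((t - \<tau>) - (s - \<tau>)) / (t - \<tau>)"
      using assms by (subst diff_divide_distrib) simp
    then have e: "1 - (s - \<tau>) / (t - \<tau>) = (t - s) / (t - \<tau>)" by simp
    \<comment> \<open>The exponents \<alpha> - 1 and -\<alpha> of the kernels and the 1 from ds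
      cancel.\<close>
    have "(t - \<tau>) powr (\<alpha> - 1) * (t - \<tau>) powr (- \<alpha>) * (t - \<tau>) = 1"
      using assms by (simp add: powr_add[symmetric] powr_neg_one)
    then show "(RL_kernel (1 - \<alpha>) (1 - (?d + ?c * s)) * RL_kernel \<alpha> (?d + ?c * s)) / (t - \<tau>) =
      RL_kernel (1 - \<alpha>) (t - s) * RL_kernel \<alpha> (s - \<tau>)"
      unfolding e2 e using assms by (auto simp: RL_kernel_def powr_divide zero_less_divide_iff mult_ac)
  qed
  finally show ?thesis .
qed

text \<open>Exchanging the integrals leaves the kernel composition, which is 1 for \<tau> < t. The
  kernels are nonnegative, so the same computation with the absolute value of h supplies the
  integrability that Fubini requires.\<close>

lemma RL_conv_RL_conv:
  assumes \<alpha>: "0 < \<alpha>" "\<alpha> < 1" and h [measurable]: "h \<in> borel_measurable borel"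
    and M: "\<And>\<tau>. \<bar>h \<tau>\<bar> \<le> M" and z: "\<And>\<tau>. \<tau> < a \<Longrightarrow> h \<tau> = 0"
  shows "RL_conv (1 - \<alpha>) (RL_conv \<alpha> h) t = (\<integral>\<tau>. h \<tau> * indicator {..<t} \<tau> \<partial>lborel)"
proof -
  let ?f = "\<lambda>\<tau> s. RL_kernel (1 - \<alpha>) (t - s) * (RL_kernel \<alpha> (s - \<tau>) * h \<tau>)"
  \<comment> \<open>The free constant c is used as h \<tau> for the value and as its absolute value
    for integrability.\<close>
  have inner: "has_bochner_integral lborel (\<lambda>s. RL_kernel (1 - \<alpha>) (t - s) * (RL_kernel \<alpha> (s - \<tau>) * c)) (c * indicator {..<t} \<tau>)" for \<tau> c :: real
  proof (cases "\<tau> < t")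
    case True
    have "has_bochner_integral lborel (\<lambda>s. RL_kernel (1 - \<alpha>) (t - s) * RL_kernel \<alpha> (s - \<tau>) * c) (1 * c)"
      by (intro has_bochner_integral_mult_left has_bochner_integral_RL_kernel_kernel \<alpha> True)
    then show ?thesis using True by (simp add: mult_ac)
  next
    case False
    then have "(\<lambda>s. RL_kernel (1 - \<alpha>) (t - s) * (RL_kernel \<alpha> (s - \<tau>) * c)) = (\<lambda>s. 0)"
      by (auto simp: RL_kernel_def)
    then show ?thesis using False by (simp add: has_bochner_integral_zero)
  qed
  have ab: "\<bar>RL_kernel (1 - \<alpha>) (t - s) * (RL_kernel \<alpha> (s - \<tau>) * h \<tau>)\<bar> = RL_kernel (1 - \<alpha>) (t - s) * (RL_kernel \<alpha> (s - \<tau>) * \<bar>h \<tau>\<bar>)" for s \<tau>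
    using \<alpha> by (simp add: abs_mult RL_kernel_nonneg)
  have "integrable (lborel \<Otimes>\<^sub>M lborel) (case_prod ?f)"
  proof (rule lborel_pair.Fubini_integrable)
    show "case_prod ?f \<in> borel_measurable (lborel \<Otimes>\<^sub>M lborel)" by measurable
    show "AE \<tau> in lborel. integrable lborel (\<lambda>s. case (\<tau>, s) of (\<tau>, s) \<Rightarrow> ?f \<tau> s)"
      using inner by (auto simp: has_bochner_integral_iff)
    have i: "integrable lborel (\<lambda>\<tau>. M * indicator {a..t} \<tau>)"
      by (intro integrable_mult_right integrable_real_indicator) (auto simp: emeasure_lborel_Icc_eq)
    have "integrable lborel (\<lambda>\<tau>. \<bar>h \<tau>\<bar> * indicator {..<t} \<tau>)"
    proof (rule Bochner_Integration.integrable_bound[OF i])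
      show "AE \<tau> in lborel. norm (\<bar>h \<tau>\<bar> * indicator {..<t} \<tau>) \<le> norm (M * indicator {a..t} \<tau>)"
      proof (rule AE_I2)
        fix \<tau> show "norm (\<bar>h \<tau>\<bar> * indicator {..<t} \<tau>) \<le> norm (M * indicator {a..t} \<tau>)"
          using M[of \<tau>] z[of \<tau>] by (cases "\<tau> < a") (auto simp: indicator_def)
      qed
    qed measurable
    then show "integrable lborel (\<lambda>\<tau>. \<integral>s. norm (case (\<tau>, s) of (\<tau>, s) \<Rightarrow> ?f \<tau> s) \<partial>lborel)"
      using inner by (simp add: ab has_bochner_integral_iff)
  qed
  from lborel_pair.Fubini_integral[OF this]
  have "(\<integral>s. (\<integral>\<tau>. ?f \<tau> s \<partial>lborel) \<partial>lborel) = (\<integral>\<tau>. (\<integral>s. ?f \<tau> s \<partial>lborel) \<partial>lborel)" .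
  also have "\<dots> = (\<integral>\<tau>. h \<tau> * indicator {..<t} \<tau> \<partial>lborel)"
    using inner by (simp add: has_bochner_integral_iff)
  also have "(\<integral>s. (\<integral>\<tau>. ?f \<tau> s \<partial>lborel) \<partial>lborel) = RL_conv (1 - \<alpha>) (RL_conv \<alpha> h) t"
    by (simp add: RL_conv_def)
  finally show ?thesis .
qed

section \<open>Riemann--Liouville integrals of bounded measurable functions\<close>

lemma RL_conv_measurable [measurable]:
  assumes [measurable]: "h \<in> borel_measurable borel"
  shows "RL_conv \<alpha> h \<in> borel_measurable borel"
  unfolding RL_conv_def by measurable

lemma RL_conv_eq_0_left:
  assumes "\<And>\<tau>. \<tau> < a \<Longrightarrow> h \<tau> = 0" "t \<le> a"
  shows "RL_conv \<alpha> h t = 0"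
proof -
  have "(\<lambda>\<tau>. RL_kernel \<alpha> (t - \<tau>) * h \<tau>) = (\<lambda>\<tau>. 0)"
    using assms by (auto simp: RL_kernel_def fun_eq_iff)
  then show ?thesis by (simp add: RL_conv_def)
qed

lemma RL_integral_raw_AE_cong:
  fixes h g :: "real \<Rightarrow> real"
  assumes [measurable]: "h \<in> borel_measurable borel"
    and z: "\<And>\<tau>. \<tau> < a \<Longrightarrow> h \<tau> = 0" and eq: "AE \<tau> in lebesgue. \<tau> \<in> {a..t} \<longrightarrow> h \<tau> = g \<tau>"
  shows "(\<lambda>\<tau>. indicator {a..t} \<tau> *\<^sub>R (1 / Gamma \<alpha> * (t - \<tau>) powr (\<alpha> - 1) * g \<tau>)) \<in> borel_measurable lebesgue" (is ?A)
    and "AE \<tau> in lebesgue. RL_kernel \<alpha> (t - \<tau>) * h \<tau> = indicator {a..t} \<tau> *\<^sub>R (1 / Gamma \<alpha> * (t - \<tau>) powr (\<alpha> - 1) * g \<tau>)" (is ?B)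
proof -
  show ?B
    using eq by eventually_elim (use z in \<open>force simp: RL_kernel_def indicator_def not_less\<close>)
  have "(\<lambda>\<tau>. RL_kernel \<alpha> (t - \<tau>) * h \<tau>) \<in> borel_measurable lebesgue"
    by (intro measurable_completion) auto
  then show ?A using \<open>?B\<close> by (rule borel_measurable_AE)
qed

text \<open>Bridge from the Lebesgue integral over [a, t] to the convolution of a Borel function: g
  enters only through its almost everywhere class on [a, t].\<close>

lemma RL_integral_raw_eq_RL_conv:
  assumes "0 < \<alpha>" and h: "h \<in> borel_measurable borel"
    "\<And>\<tau>. \<tau> < a \<Longrightarrow> h \<tau> = 0" "AE \<tau> in lebesgue. \<tau> \<in> {a..t} \<longrightarrow> h \<tau> = g \<tau>"
  shows "RL_integral_raw a \<alpha> g t = RL_conv \<alpha> h t"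
proof -
  note [measurable] = h(1)
  have "RL_conv \<alpha> h t = (\<integral>\<tau>. RL_kernel \<alpha> (t - \<tau>) * h \<tau> \<partial>lebesgue)"
    unfolding RL_conv_def by (intro integral_completion[symmetric]) auto
  also have "\<dots> = (\<integral>\<tau>. indicator {a..t} \<tau> *\<^sub>R (1 / Gamma \<alpha> * (t - \<tau>) powr (\<alpha> - 1) * g \<tau>) \<partial>lebesgue)"
    by (rule integral_cong_AE[OF _ RL_integral_raw_AE_cong[OF h]]) (intro measurable_completion; simp)
  finally show ?thesis using assms(1) by (simp add: RL_integral_raw_def set_lebesgue_integral_def)
qed

lemma bounded_measurable_Borel_version:
  fixes g :: "real \<Rightarrow> real"
  assumes g: "g \<in> borel_measurable (lebesgue_on {a..b})" and M: "AE \<tau> in lebesgue_on {a..b}. \<bar>g \<tau>\<bar> \<le> M" "0 \<le> M"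
  shows "\<exists>h\<in>borel_measurable borel. (\<forall>\<tau>. \<bar>h \<tau>\<bar> \<le> M) \<and> (\<forall>\<tau><a. h \<tau> = 0) \<and>
    (AE \<tau> in lebesgue. \<tau> \<in> {a..b} \<longrightarrow> h \<tau> = g \<tau>)"
proof -
  have "(\<lambda>\<tau>. if \<tau> \<in> {a..b} then g \<tau> else 0) \<in> borel_measurable lebesgue"
    using borel_measurable_if_I[OF g] by simp
  from completion_ex_borel_measurable_real[OF this]
  obtain h0 where h0 [measurable]: "h0 \<in> borel_measurable borel"
    and ae: "AE \<tau> in lborel. (if \<tau> \<in> {a..b} then g \<tau> else 0) = h0 \<tau>" by auto
  \<comment> \<open>Clipping at M and -M makes the bound hold everywhere and changes h0 on [a, b]
    only in a null set; the cutoff yields the vanishing to the left of a.\<close>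
  define h where "h \<tau> = (if \<tau> \<in> {a..b} then max (- M) (min M (h0 \<tau>)) else 0)" for \<tau>
  show ?thesis
  proof (intro bexI[of _ h] conjI allI impI)
    show "h \<in> borel_measurable borel" unfolding h_def by measurable
    show "\<bar>h \<tau>\<bar> \<le> M" for \<tau> using M(2) by (auto simp: h_def)
    show "h \<tau> = 0" if "\<tau> < a" for \<tau> using that by (simp add: h_def)
    have "AE \<tau> in lebesgue. \<tau> \<in> {a..b} \<longrightarrow> \<bar>g \<tau>\<bar> \<le> M"
      using M(1) by (subst (asm) AE_restrict_space_iff) auto
    with AE_completion[OF ae] show "AE \<tau> in lebesgue. \<tau> \<in> {a..b} \<longrightarrow> h \<tau> = g \<tau>"
      by eventually_elim (auto simp: h_def)
  qed
qed

lemma AE_lebesgue_on_interval_iff: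
  fixes a b :: real
  shows "(AE \<tau> in lebesgue_on {a..b}. P \<tau>) \<longleftrightarrow> (AE \<tau> in lebesgue. \<tau> \<in> {a..b} \<longrightarrow> P \<tau>)"
  by (rule AE_restrict_space_iff) auto

text \<open>The common class of the right-hand sides f(q(t), t), bounded only almost everywhere, and
  of continuous functions on [a, b]; on it the Riemann-Liouville integrals of every positive order
  converge.\<close>

locale bounded_measurable_on =
  fixes a b M :: real and g :: "real \<Rightarrow> real"
  assumes meas: "g \<in> borel_measurable (lebesgue_on {a..b})"
    and bound: "AE \<tau> in lebesgue_on {a..b}. \<bar>g \<tau>\<bar> \<le> M" and M_nonneg: "0 \<le> M"
begin

text \<open>One h serves all orders and all t \<le> b at once, so that integrals of different orders
  are computed with the same function.\<close>

lemma Borel_version: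
  "\<exists>h\<in>borel_measurable borel. (\<forall>\<tau>. \<bar>h \<tau>\<bar> \<le> M) \<and> (\<forall>\<tau><a. h \<tau> = 0) \<and>
    (AE \<tau> in lebesgue. \<tau> \<in> {a..b} \<longrightarrow> h \<tau> = g \<tau>) \<and>
    (\<forall>\<alpha>>0. \<forall>t\<le>b. RL_integral_raw a \<alpha> g t = RL_conv \<alpha> h t)"
proof -
  obtain h where h: "h \<in> borel_measurable borel" "\<And>\<tau>. \<bar>h \<tau>\<bar> \<le> M" "\<And>\<tau>. \<tau> < a \<Longrightarrow> h \<tau> = 0"
    "AE \<tau> in lebesgue. \<tau> \<in> {a..b} \<longrightarrow> h \<tau> = g \<tau>"
    using bounded_measurable_Borel_version[OF meas bound M_nonneg] by blast
  have "RL_integral_raw a \<alpha> g t = RL_conv \<alpha> h t" if "0 < \<alpha>" "t \<le> b" for \<alpha> t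
  proof (rule RL_integral_raw_eq_RL_conv[OF \<open>0 < \<alpha>\<close> h(1,3)])
    show "AE \<tau> in lebesgue. \<tau> \<in> {a..t} \<longrightarrow> h \<tau> = g \<tau>"
      using h(4) by eventually_elim (use \<open>t \<le> b\<close> in auto)
  qed
  with h show ?thesis by blast
qed

lemma continuous_on_RL_integral_raw:
  assumes "0 < \<alpha>" "\<alpha> \<le> 1"
  shows "continuous_on {a..b} (RL_integral_raw a \<alpha> g)"
proof -
  obtain h where h: "h \<in> borel_measurable borel" "\<And>\<tau>. \<bar>h \<tau>\<bar> \<le> M" "\<And>\<tau>. \<tau> < a \<Longrightarrow> h \<tau> = 0"
    "\<And>\<alpha> t. 0 < \<alpha> \<Longrightarrow> t \<le> b \<Longrightarrow> RL_integral_raw a \<alpha> g t = RL_conv \<alpha> h t"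
    using Borel_version by blast
  have "continuous_on {a..b} (RL_conv \<alpha> h)"
    using continuous_on_RL_conv[OF assms h(1-3)] by (rule continuous_on_subset) auto
  then show ?thesis
    by (rule continuous_on_eq) (use h(4) assms in auto)
qed

lemma RL_integral_raw_at_left: "0 < \<alpha> \<Longrightarrow> a \<le> b \<Longrightarrow> RL_integral_raw a \<alpha> g a = 0"
  using Borel_version RL_conv_eq_0_left[of a _ a] by force

lemma absolutely_integrable: "t \<le> b \<Longrightarrow> g absolutely_integrable_on {a..t}"
proof -
  assume "t \<le> b"
  have i: "integrable (lebesgue_on {a..b}) (\<lambda>\<tau>. M)"
    by (simp add: integrable_restrict_space)
  have "integrable (lebesgue_on {a..b}) g"
    by (rule Bochner_Integration.integrable_bound[OF i meas]) (use bound M_nonneg in auto)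
  then have "g absolutely_integrable_on {a..b}"
    by (simp add: set_integrable_def integrable_restrict_space)
  then show ?thesis by (rule set_integrable_subset) (use \<open>t \<le> b\<close> in auto)
qed

lemma integral_eq_Borel_version:
  assumes h: "h \<in> borel_measurable borel" "\<And>\<tau>. \<tau> < a \<Longrightarrow> h \<tau> = 0"
    and eq: "AE \<tau> in lebesgue. \<tau> \<in> {a..b} \<longrightarrow> h \<tau> = g \<tau>" and "t \<le> b"
  shows "integral {a..t} g = (\<integral>\<tau>. h \<tau> * indicator {..<t} \<tau> \<partial>lborel)"
proof -
  note [measurable] = h(1)
  have i: "set_integrable lebesgue {a..t} g" using absolutely_integrable[OF \<open>t \<le> b\<close>] .
  have "integral {a..t} g = (LINT \<tau>:{a..t}|lebesgue. g \<tau>)"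
    using set_lebesgue_integral_eq_integral(2)[OF i] by simp
  also have "\<dots> = (\<integral>\<tau>. h \<tau> * indicator {..<t} \<tau> \<partial>lebesgue)"
    unfolding set_lebesgue_integral_def
  proof (rule integral_cong_AE)
    show "(\<lambda>\<tau>. indicator {a..t} \<tau> *\<^sub>R g \<tau>) \<in> borel_measurable lebesgue"
      using i by (auto simp: set_integrable_def)
    show "(\<lambda>\<tau>. h \<tau> * indicator {..<t} \<tau>) \<in> borel_measurable lebesgue"
      by (intro measurable_completion) auto
    \<comment> \<open>The closed and the half-open range of integration differ only in the point
      t.\<close>
    have "AE \<tau> in lebesgue. \<tau> \<noteq> t" by (intro AE_completion AE_lborel_singleton)
    with eq show "AE \<tau> in lebesgue. indicator {a..t} \<tau> *\<^sub>R g \<tau> = h \<tau> * indicator {..<t} \<tau>"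
      by eventually_elim (use \<open>t \<le> b\<close> h(2) in \<open>force simp: indicator_def\<close>)
  qed
  also have "\<dots> = (\<integral>\<tau>. h \<tau> * indicator {..<t} \<tau> \<partial>lborel)"
    by (intro integral_completion) auto
  finally show ?thesis .
qed

lemma RL_integral_raw_1:
  assumes "t \<le> b"
  shows "RL_integral_raw a 1 g t = integral {a..t} g"
proof -
  obtain h where h: "h \<in> borel_measurable borel" "\<And>\<tau>. \<bar>h \<tau>\<bar> \<le> M" "\<And>\<tau>. \<tau> < a \<Longrightarrow> h \<tau> = 0"
    "AE \<tau> in lebesgue. \<tau> \<in> {a..b} \<longrightarrow> h \<tau> = g \<tau>"
    "\<And>\<alpha> t. 0 < \<alpha> \<Longrightarrow> t \<le> b \<Longrightarrow> RL_integral_raw a \<alpha> g t = RL_conv \<alpha> h t"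
    using Borel_version by blast
  have "RL_kernel 1 (t - \<tau>) * h \<tau> = h \<tau> * indicator {..<t} \<tau>" for \<tau>
    by (simp add: RL_kernel_def indicator_def)
  then have "RL_conv 1 h t = (\<integral>\<tau>. h \<tau> * indicator {..<t} \<tau> \<partial>lborel)"
    unfolding RL_conv_def by (simp only:)
  then show ?thesis using h(5)[of 1 t] assms integral_eq_Borel_version[OF h(1,3,4) assms] by simp
qed

text \<open>On [a, b] the inner integral is \<open>RL_conv \<alpha> h\<close>, which is Borel and
  zero to the left of a, hence admissible as the Borel version inside the outer integral.\<close>

lemma RL_integral_raw_semigroup:
  assumes "0 < \<alpha>" "\<alpha> < 1" "t \<le> b"
  shows "RL_integral_raw a (1 - \<alpha>) (RL_integral_raw a \<alpha> g) t = integral {a..t} g"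
proof -
  obtain h where h: "h \<in> borel_measurable borel" "\<And>\<tau>. \<bar>h \<tau>\<bar> \<le> M" "\<And>\<tau>. \<tau> < a \<Longrightarrow> h \<tau> = 0"
    "AE \<tau> in lebesgue. \<tau> \<in> {a..b} \<longrightarrow> h \<tau> = g \<tau>"
    "\<And>\<alpha> t. 0 < \<alpha> \<Longrightarrow> t \<le> b \<Longrightarrow> RL_integral_raw a \<alpha> g t = RL_conv \<alpha> h t"
    using Borel_version by blast
  have "RL_integral_raw a (1 - \<alpha>) (RL_integral_raw a \<alpha> g) t = RL_conv (1 - \<alpha>) (RL_conv \<alpha> h) t"
  proof (rule RL_integral_raw_eq_RL_conv)
    show "RL_conv \<alpha> h \<in> borel_measurable borel" using h(1) by (rule RL_conv_measurable)
    show "RL_conv \<alpha> h \<tau> = 0" if "\<tau> < a" for \<tau>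
      by (rule RL_conv_eq_0_left[of a]) (use h(3) that in auto)
    show "AE \<tau> in lebesgue. \<tau> \<in> {a..t} \<longrightarrow> RL_conv \<alpha> h \<tau> = RL_integral_raw a \<alpha> g \<tau>"
      using h(5) assms by auto
  qed (use assms in auto)
  also have "\<dots> = (\<integral>\<tau>. h \<tau> * indicator {..<t} \<tau> \<partial>lborel)"
    by (rule RL_conv_RL_conv[OF assms(1,2) h(1-3)])
  finally show ?thesis using integral_eq_Borel_version[OF h(1,3,4) assms(3)] by simp
qed

text \<open>Linearity rests on this convergence, because a divergent integral has the default value
  0.\<close>

lemma set_integrable_RL_integrand:
  assumes "0 < \<alpha>" "t \<le> b"
  shows "set_integrable lebesgue {a..t} (\<lambda>\<tau>. 1 / Gamma \<alpha> * (t - \<tau>) powr (\<alpha> - 1) * g \<tau>)"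
proof (cases "a \<le> t")
  case True
  obtain h where h: "h \<in> borel_measurable borel" "\<And>\<tau>. \<bar>h \<tau>\<bar> \<le> M" "\<And>\<tau>. \<tau> < a \<Longrightarrow> h \<tau> = 0"
    "AE \<tau> in lebesgue. \<tau> \<in> {a..b} \<longrightarrow> h \<tau> = g \<tau>"
    "\<And>\<alpha> t. 0 < \<alpha> \<Longrightarrow> t \<le> b \<Longrightarrow> RL_integral_raw a \<alpha> g t = RL_conv \<alpha> h t"
    using Borel_version by blast
  note [measurable] = h(1)
  have eq: "AE \<tau> in lebesgue. \<tau> \<in> {a..t} \<longrightarrow> h \<tau> = g \<tau>"
    using h(4) by eventually_elim (use \<open>t \<le> b\<close> in auto)
  have "integrable lborel (\<lambda>\<tau>. RL_kernel \<alpha> (t - \<tau>) * h \<tau>)"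
    using assms(1) True h by (intro integrable_RL_conv[where c=a and M=M]) auto
  then have "integrable lebesgue (\<lambda>\<tau>. RL_kernel \<alpha> (t - \<tau>) * h \<tau>)"
    by (subst integrable_completion) auto
  then show ?thesis
    unfolding set_integrable_def
    by (rule integrable_cong_AE_imp[OF _ RL_integral_raw_AE_cong[OF h(1,3) eq]])
qed (simp add: set_integrable_def)

text \<open>The memory term drops out: where g vanishes on [a, T), only the kernel mass on [T, t] is
  left, small when t is close to T.\<close>

lemma abs_RL_integral_raw_le:
  assumes "0 < \<alpha>" "a \<le> T" "T \<le> t" "t \<le> b" and z: "\<And>\<tau>. a \<le> \<tau> \<Longrightarrow> \<tau> < T \<Longrightarrow> g \<tau> = 0"
  shows "\<bar>RL_integral_raw a \<alpha> g t\<bar> \<le> M * ((t - T) powr \<alpha> / Gamma (\<alpha> + 1))"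
proof -
  obtain h where h: "h \<in> borel_measurable borel" "\<And>\<tau>. \<bar>h \<tau>\<bar> \<le> M" "\<And>\<tau>. \<tau> < a \<Longrightarrow> h \<tau> = 0"
    "AE \<tau> in lebesgue. \<tau> \<in> {a..b} \<longrightarrow> h \<tau> = g \<tau>"
    "\<And>\<alpha> t. 0 < \<alpha> \<Longrightarrow> t \<le> b \<Longrightarrow> RL_integral_raw a \<alpha> g t = RL_conv \<alpha> h t"
    using Borel_version by blast
  note [measurable] = h(1)
  \<comment> \<open>g vanishes everywhere on [a, T), its Borel version only almost everywhere, hence
    the truncation.\<close>
  define h' where "h' \<tau> = (if T \<le> \<tau> then h \<tau> else 0)" for \<tau>
  have [measurable]: "h' \<in> borel_measurable borel" unfolding h'_def by measurable
  have "RL_integral_raw a \<alpha> g t = RL_conv \<alpha> h' t"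
  proof (rule RL_integral_raw_eq_RL_conv[OF assms(1)])
    show "h' \<tau> = 0" if "\<tau> < a" for \<tau> using that assms(2) by (simp add: h'_def)
    show "AE \<tau> in lebesgue. \<tau> \<in> {a..t} \<longrightarrow> h' \<tau> = g \<tau>"
      using h(4) by eventually_elim (use z assms(4) in \<open>auto simp: h'_def\<close>)
  qed simp
  also have "\<bar>\<dots>\<bar> \<le> M * ((t - T) powr \<alpha> / Gamma (\<alpha> + 1))"
    using assms h(2) M_nonneg by (intro abs_RL_conv_le) (auto simp: h'_def)
  finally show ?thesis .
qed

end

section \<open>Linearity and inversion of the Riemann-Liouville integral\<close>

text \<open>The condition a \<le> t puts t into [a, t]; the order 0 needs this, where the integral
  is the value at t itself.\<close>

lemma RL_integral_raw_cong:
  assumes "\<And>\<tau>. \<tau> \<in> {a..t} \<Longrightarrow> p \<tau> = q \<tau>" "a \<le> t"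
  shows "RL_integral_raw a \<alpha> p t = RL_integral_raw a \<alpha> q t"
proof -
  have "(\<lambda>\<tau>. indicator {a..t} \<tau> *\<^sub>R (1 / Gamma \<alpha> * (t - \<tau>) powr (\<alpha> - 1) * p \<tau>)) =
    (\<lambda>\<tau>. indicator {a..t} \<tau> *\<^sub>R (1 / Gamma \<alpha> * (t - \<tau>) powr (\<alpha> - 1) * q \<tau>))"
    using assms by (auto simp: indicator_def fun_eq_iff)
  then show ?thesis using assms by (simp only: RL_integral_raw_def set_lebesgue_integral_def) simp
qed

lemma RL_integral_raw_diff:
  assumes "bounded_measurable_on a b M p" "bounded_measurable_on a b M' q" "0 < \<alpha>" "t \<le> b"
  shows "RL_integral_raw a \<alpha> (\<lambda>\<tau>. p \<tau> - q \<tau>) t = RL_integral_raw a \<alpha> p t - RL_integral_raw a \<alpha> q t"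
  using set_integral_diff(2)[OF bounded_measurable_on.set_integrable_RL_integrand[OF assms(1,3,4)]
      bounded_measurable_on.set_integrable_RL_integrand[OF assms(2,3,4)]] \<open>0 < \<alpha>\<close>
  by (simp add: RL_integral_raw_def right_diff_distrib)

lemma continuous_imp_bounded_measurable_on:
  assumes "continuous_on {a..b} p"
  obtains M where "bounded_measurable_on a b M p"
proof -
  have "bounded (p ` {a..b})" using assms compact_Icc compact_continuous_image compact_imp_bounded by blast
  then obtain M where "\<forall>x\<in>p ` {a..b}. norm x \<le> M" unfolding bounded_iff by blast
  then have M: "\<bar>p t\<bar> \<le> M" if "t \<in> {a..b}" for t using that by simp
  show thesis
  proof (rule that, unfold_locales)
    show "p \<in> borel_measurable (lebesgue_on {a..b})"
      using assms by (intro continuous_imp_measurable_on_sets_lebesgue) auto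
    \<comment> \<open>When [a, b] is empty the bound M may be negative, hence the maximum with
      0.\<close>
    show "AE \<tau> in lebesgue_on {a..b}. \<bar>p \<tau>\<bar> \<le> max M 0"
      unfolding AE_lebesgue_on_interval_iff using M by (auto intro!: AE_I2 simp: le_max_iff_disj)
    show "0 \<le> max M 0" by simp
  qed
qed

lemma continuous_integral_eq_0_imp_eq_0:
  fixes p :: "real \<Rightarrow> real"
  assumes p: "continuous_on {a..b} p" and z: "\<And>t. t \<in> {a..b} \<Longrightarrow> integral {a..t} p = 0" and "a < b" "t \<in> {a..b}"
  shows "p t = 0"
proof -
  have "((\<lambda>u. integral {a..u} p) has_vector_derivative p t) (at t within {a..b})"
    by (rule integral_has_vector_derivative[OF p \<open>t \<in> {a..b}\<close>])
  then have "((\<lambda>u. 0) has_vector_derivative p t) (at t within {a..b})"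
    by (rule has_vector_derivative_transform[OF \<open>t \<in> {a..b}\<close>, rotated]) (use z in simp)
  moreover have "((\<lambda>u. 0::real) has_vector_derivative 0) (at t within {a..b})"
    by (rule has_vector_derivative_const)
  ultimately show ?thesis
    using vector_derivative_unique_within_closed_interval[of a b t "\<lambda>u. 0" "p t" 0] assms(3,4) by simp
qed

text \<open>Inverting \<open>I\<^sup>1\<^sup>-\<^sup>\<alpha>\<close>: apply \<open>I\<^sup>\<alpha>\<close> to \<open>I\<^sup>1\<^sup>-\<^sup>\<alpha> (p - I\<^sup>\<alpha> g) = 0\<close>
  to get \<open>I\<^sup>1 (p - I\<^sup>\<alpha> g) = 0\<close>.\<close>

lemma RL_integral_raw_inversion:
  assumes g: "bounded_measurable_on a b M g" and p: "continuous_on {a..b} p" "p a = 0"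
    and \<alpha>: "0 < \<alpha>" "\<alpha> \<le> 1" and "a \<le> b"
  shows "(\<forall>t\<in>{a..b}. RL_integral_raw a (1 - \<alpha>) p t = integral {a..t} g) \<longleftrightarrow>
         (\<forall>t\<in>{a..b}. p t = RL_integral_raw a \<alpha> g t)" (is "?L \<longleftrightarrow> ?R")
\<comment> \<open>For \<alpha> = 1 the operator of order 1 - \<alpha> is the identity and not an
  integral with a kernel.\<close>
proof (cases "\<alpha> = 1")
  case True
  then show ?thesis
    using bounded_measurable_on.RL_integral_raw_1[OF g] by (simp add: RL_integral_raw_def[of _ 0])
next
  case False
  then have "\<alpha> < 1" using \<alpha> by simp
  note semi = bounded_measurable_on.RL_integral_raw_semigroup
  show ?thesis
  proof
    assume ?R
    then show ?L using semi[OF g \<alpha>(1) \<open>\<alpha> < 1\<close>] RL_integral_raw_cong[of a _ p "RL_integral_raw a \<alpha> g" "1 - \<alpha>"]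
      by simp
  next
    assume L: ?L
    define r where "r t = p t - RL_integral_raw a \<alpha> g t" for t
    have cg: "continuous_on {a..b} (RL_integral_raw a \<alpha> g)"
      using bounded_measurable_on.continuous_on_RL_integral_raw[OF g \<alpha>] .
    have cr: "continuous_on {a..b} r" unfolding r_def using p(1) cg by (intro continuous_intros)
    obtain Mp where Mp: "bounded_measurable_on a b Mp p" using p(1) by (rule continuous_imp_bounded_measurable_on)
    obtain Mg where Mg: "bounded_measurable_on a b Mg (RL_integral_raw a \<alpha> g)"
      using cg by (rule continuous_imp_bounded_measurable_on)
    obtain Mr where Mr: "bounded_measurable_on a b Mr r" using cr by (rule continuous_imp_bounded_measurable_on)
    have r0: "RL_integral_raw a (1 - \<alpha>) r t = 0" if "t \<in> {a..b}" for t
      unfolding r_def using RL_integral_raw_diff[OF Mp Mg, of "1 - \<alpha>" t] semi[OF g \<alpha>(1) \<open>\<alpha> < 1\<close>, of t] L that \<open>\<alpha> < 1\<close>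
      by simp
    have "integral {a..t} r = 0" if t: "t \<in> {a..b}" for t
    proof -
      \<comment> \<open>The composition rule with the orders \<alpha> and 1 - \<alpha> exchanged; it
        applies to r because r is continuous.\<close>
      have "integral {a..t} r = RL_integral_raw a (1 - (1 - \<alpha>)) (RL_integral_raw a (1 - \<alpha>) r) t"
        using semi[OF Mr, of "1 - \<alpha>" t] \<alpha> \<open>\<alpha> < 1\<close> t by simp
      also have "\<dots> = RL_integral_raw a (1 - (1 - \<alpha>)) (\<lambda>\<tau>. 0) t"
        using t r0 by (intro RL_integral_raw_cong) auto
      also have "\<dots> = 0" using \<alpha> by (simp add: RL_integral_raw_def)
      finally show ?thesis .
    qed
    note int0 = this
    have "r t = 0" if t: "t \<in> {a..b}" for t
    \<comment> \<open>Differentiation needs a nondegenerate interval. For a = b the claim is the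
      initial value p a = 0.\<close>
    proof (cases "a < b")
      case True
      show ?thesis by (rule continuous_integral_eq_0_imp_eq_0[OF cr int0 True t])
    next
      case False
      then have "t = a" using t by simp
      then show ?thesis
        using p(2) bounded_measurable_on.RL_integral_raw_at_left[OF g \<alpha>(1) \<open>a \<le> b\<close>] by (simp add: r_def)
    qed
    then show ?R by (simp add: r_def)
  qed
qed

section \<open>The scalar Caputo equation as an integral equation\<close>

text \<open>The exceptional set in \<open>le\<close> depends on x. Over a countable dense subset of
  K these sets unite to one null set, and off it continuity carries the bound to all of K.\<close>

lemma AE_ball_le_of_continuous:
  fixes K :: "'a::{metric_space, second_countable_topology} set" and G :: "'a \<Rightarrow> 'b \<Rightarrow> real"
  assumes cont: "AE t in M. continuous_on K (\<lambda>x. G x t)" and le: "\<And>x. x \<in> K \<Longrightarrow> AE t in M. G x t \<le> B"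
  shows "AE t in M. \<forall>x\<in>K. G x t \<le> B"
proof -
  obtain D where D: "countable D" "D \<subseteq> K" "K \<subseteq> closure D"
    using separable by blast
  have "AE t in M. \<forall>x\<in>D. G x t \<le> B"
    using D(1,2) le by (subst AE_ball_countable) auto
  with cont show ?thesis
  proof eventually_elim
    fix t assume c: "continuous_on K (\<lambda>x. G x t)" and d: "\<forall>x\<in>D. G x t \<le> B"
    show "\<forall>x\<in>K. G x t \<le> B"
    proof
      fix x assume "x \<in> K"
      with D(3) have "x \<in> closure D" by blast
      then obtain s where s: "\<And>n. s n \<in> D" "s \<longlonglongrightarrow> x"
        unfolding closure_sequential by blast
      have "(\<lambda>n. G (s n) t) \<longlonglongrightarrow> G x t"
        using s(1) D(2) \<open>x \<in> K\<close> by (intro continuous_on_tendsto_compose[OF c s(2)]) (auto intro!: always_eventually)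
      then show "G x t \<le> B"
        by (rule LIMSEQ_le_const2) (use s(1) d in blast)
    qed
  qed
qed

lemma AE_lebesgueD:
  "AE t in lebesgue. P t \<Longrightarrow> \<exists>N\<in>null_sets lebesgue. \<forall>t. t \<notin> N \<longrightarrow> P t"
  unfolding completion.AE_iff_null_sets by auto

section \<open>Intervals with left end point a\<close>

lemma intervals_fromD:
  assumes "I \<in> intervals_from a"
  shows "a \<in> I" "\<And>t. t \<in> I \<Longrightarrow> a \<le> t" "\<And>s t. s \<in> I \<Longrightarrow> t \<in> I \<Longrightarrow> {s..t} \<subseteq> I" "\<exists>b\<in>I. a < b"
    "I \<in> sets lebesgue"
proof -
  have i: "is_interval I" and s: "{a} \<subset> I" and g: "I \<subseteq> {a..}" using assms by (auto simp: intervals_from_def)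
  show "a \<in> I" using s by blast
  show ge: "a \<le> t" if "t \<in> I" for t using g that by auto
  show "{s..t} \<subseteq> I" if "s \<in> I" "t \<in> I" for s t
    using mem_is_interval_1_I[OF i that] by auto
  obtain b where "b \<in> I" "b \<noteq> a" using s by blast
  with ge[OF this(1)] show "\<exists>b\<in>I. a < b" by (intro bexI[of _ b]) auto
  show "I \<in> sets lebesgue" using real_interval_borel_measurable[OF i] by simp
qed

text \<open>I may be unbounded or open on the right. Near each t it looks like a compact [a, b], and
  b comes from a countable set so that the exceptional null sets of the [a, b] can be
  united.\<close>

lemma intervals_from_exhaustion:
  assumes I: "I \<in> intervals_from a"
  shows "\<exists>B. countable B \<and> B \<subseteq> I \<and> (\<forall>t\<in>I. \<exists>b\<in>B. t \<le> b \<and> at t within I = at t within {a..b})"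
proof (intro exI conjI ballI)
  \<comment> \<open>Rational end points serve every t below another point of I; the maximum of I, if
    there is one, has to be added.\<close>
  let ?B = "(\<rat> \<inter> I) \<union> {b\<in>I. \<forall>y\<in>I. y \<le> b}"
  have "{b\<in>I. \<forall>y\<in>I. y \<le> b} \<subseteq> {Sup I}" by (auto intro!: cSup_eq_maximum[symmetric])
  then show "countable ?B"
    by (intro countable_Un countable_Int1[OF countable_rat]) (rule countable_subset, assumption, simp)
  show "?B \<subseteq> I" by auto
  fix t assume t: "t \<in> I"
  note ID = intervals_fromD[OF I]
  show "\<exists>b\<in>?B. t \<le> b \<and> at t within I = at t within {a..b}"
  proof (cases "\<forall>y\<in>I. y \<le> t")
    case True
    then have "I \<subseteq> {a..t}" using ID(2) by (intro subsetI) simp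
    then have "I = {a..t}" using ID(3)[OF ID(1) t] by (rule subset_antisym)
    then have "at t within I = at t within {a..t}" by simp
    then show ?thesis using t True by (intro bexI[of _ t]) auto
  next
    case False
    then obtain y where y: "y \<in> I" "t < y" by (auto simp: not_le)
    obtain b where b: "b \<in> \<rat>" "t < b" "b < y" using Rats_dense_in_real[OF y(2)] by blast
    have bI: "b \<in> I" using ID(3)[OF t y(1)] b by auto
    have "I \<inter> {..<b} = {a..b} \<inter> {..<b}" using ID(2) subsetD[OF ID(3)[OF ID(1) bI]] by auto
    then have "at t within I = at t within {a..b}"
      using b by (intro at_within_nhd[of t "{..<b}"]) auto
    then show ?thesis using b bI by (intro bexI[of _ b]) auto
  qed
qed

lemma continuous_on_intervals_from:
  assumes I: "I \<in> intervals_from a" and "\<And>b. b \<in> I \<Longrightarrow> continuous_on {a..b} F"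
  shows "continuous_on I F"
  unfolding continuous_on_def
proof
  fix t assume t: "t \<in> I"
  obtain b where b: "b \<in> I" "t \<le> b" "at t within I = at t within {a..b}"
    using intervals_from_exhaustion[OF I] t by blast
  show "(F \<longlongrightarrow> F t) (at t within I)"
    using assms(2)[OF b(1)] intervals_fromD(2)[OF I t] b(2) unfolding b(3) continuous_on_def by simp
qed

text \<open>This makes the continuous version of a Riemann-Liouville integral unique on I: a
  discrepancy at one point would persist on an interval of positive length.\<close>

lemma continuous_AE_eq_imp_eq:
  fixes F G :: "real \<Rightarrow> real"
  assumes I: "I \<in> intervals_from a" and c: "continuous_on I F" "continuous_on I G"
    and ae: "AE t in lebesgue_on I. F t = G t" and t: "t \<in> I"
  shows "F t = G t"
proof (rule ccontr)
  assume ne: "F t \<noteq> G t"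
  note ID = intervals_fromD[OF I]
  have ae': "AE s in lebesgue. s \<in> I \<longrightarrow> F s = G s"
    using ae ID(5) by (subst (asm) AE_restrict_space_iff) auto
  have "continuous_on I (\<lambda>s. \<bar>F s - G s\<bar>)" using c by (intro continuous_intros)
  moreover have "0 < \<bar>F t - G t\<bar>" using ne by simp
  ultimately obtain e where e: "e > 0" "\<And>s. s \<in> I \<Longrightarrow> dist s t < e \<Longrightarrow> dist \<bar>F s - G s\<bar> \<bar>F t - G t\<bar> < \<bar>F t - G t\<bar>"
    using t unfolding continuous_on_iff by metis
  have ns: "F s \<noteq> G s" if "s \<in> I" "dist s t < e" for s
    using e(2)[OF that] by (auto simp: dist_real_def)
  obtain b where b: "b \<in> I" "a < b" using ID(4) by blast
  \<comment> \<open>t may be an end point of I, so a one-sided interval is chosen: to the left of t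
    unless t = a.\<close>
  obtain l u where lu: "l < u" "{l..u} \<subseteq> I" "\<And>s. s \<in> {l..u} \<Longrightarrow> dist s t < e"
  proof (cases "a < t")
    case True
    show thesis
      by (rule that[of "max a (t - e / 2)" t])
        (use True e(1) ID(3)[OF ID(1) t] in \<open>auto simp: dist_real_def\<close>)
  next
    case False
    then have "t = a" using ID(2)[OF t] by simp
    show thesis
      by (rule that[of a "min b (a + e / 2)"])
        (use b e(1) ID(3)[OF ID(1) b(1)] \<open>t = a\<close> in \<open>auto simp: dist_real_def\<close>)
  qed
  have "AE s in lebesgue. s \<notin> {l..u}"
    using ae'
  proof eventually_elim
    fix s assume eq: "s \<in> I \<longrightarrow> F s = G s"
    show "s \<notin> {l..u}"
    proof
      assume s: "s \<in> {l..u}"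
      have "s \<in> I" by (rule subsetD[OF lu(2) s])
      with ns[OF this lu(3)[OF s]] eq show False by blast
    qed
  qed
  then have "{l..u} \<in> null_sets lebesgue" by (subst AE_iff_null_sets) auto
  then have "emeasure lebesgue {l..u} = 0" by (rule null_setsD1)
  moreover have "emeasure lebesgue {l..u} = ennreal (u - l)" by (simp add: less_imp_le[OF lu(1)])
  ultimately have "ennreal (u - l) = 0" by (simp only:)
  then have "u - l \<le> 0" by (simp only: ennreal_eq_0_iff)
  with lu(1) show False by linarith
qed

section \<open>Absolute continuity and differentiation of primitives\<close>

lemma AC_on_Lipschitz:
  assumes "\<And>s t. s \<in> S \<Longrightarrow> t \<in> S \<Longrightarrow> s \<le> t \<Longrightarrow> \<bar>F t - F s\<bar> \<le> L * (t - s)" "0 \<le> L"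
  shows "F \<in> AC_on S"
  unfolding AC_on_def
proof (intro CollectI allI impI)
  fix \<epsilon> :: real assume "\<epsilon> > 0"
  show "\<exists>\<delta>>0. \<forall>(n::nat) x y. (\<forall>k<n. x k \<le> y k \<and> {x k..y k} \<subseteq> S) \<longrightarrow>
     disjoint_family_on (\<lambda>k. {x k<..<y k}) {..<n} \<longrightarrow>
     (\<Sum>k<n. y k - x k) < \<delta> \<longrightarrow> (\<Sum>k<n. \<bar>F (y k) - F (x k)\<bar>) < \<epsilon>"
  \<comment> \<open>L + 1 instead of L covers the case L = 0.\<close>
  proof (intro exI[of _ "\<epsilon> / (L + 1)"] conjI allI impI)
    show "0 < \<epsilon> / (L + 1)" using \<open>\<epsilon> > 0\<close> assms(2) by simp
    fix n :: nat and x y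
    assume xy: "\<forall>k<n. x k \<le> y k \<and> {x k..y k} \<subseteq> S" and s: "(\<Sum>k<n. y k - x k) < \<epsilon> / (L + 1)"
    have nn: "0 \<le> (\<Sum>k<n. y k - x k)" using xy by (intro sum_nonneg) auto
    have "(\<Sum>k<n. \<bar>F (y k) - F (x k)\<bar>) \<le> (\<Sum>k<n. L * (y k - x k))"
    proof (rule sum_mono)
      fix k assume "k \<in> {..<n}"
      then have "x k \<le> y k" "{x k..y k} \<subseteq> S" using xy by auto
      then show "\<bar>F (y k) - F (x k)\<bar> \<le> L * (y k - x k)" by (intro assms(1)) auto
    qed
    also have "\<dots> = L * (\<Sum>k<n. y k - x k)" by (simp add: sum_distrib_left)
    also have "\<dots> \<le> (L + 1) * (\<Sum>k<n. y k - x k)" using nn by (intro mult_right_mono) auto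
    also have "\<dots> < \<epsilon>" using s assms(2) by (simp add: field_simps)
    finally show "(\<Sum>k<n. \<bar>F (y k) - F (x k)\<bar>) < \<epsilon>" .
  qed
qed

lemma AC_on_diff:
  assumes "F \<in> AC_on S" "G \<in> AC_on S"
  shows "(\<lambda>t. F t - G t) \<in> AC_on S"
  unfolding AC_on_def
proof (intro CollectI allI impI)
  fix \<epsilon> :: real assume "\<epsilon> > 0"
  then have "\<epsilon> / 2 > 0" by simp
  obtain d1 where d1: "d1 > 0" "\<And>(n::nat) x y. (\<forall>k<n. x k \<le> y k \<and> {x k..y k} \<subseteq> S) \<Longrightarrow>
     disjoint_family_on (\<lambda>k. {x k<..<y k}) {..<n} \<Longrightarrow>
     (\<Sum>k<n. y k - x k) < d1 \<Longrightarrow> (\<Sum>k<n. \<bar>F (y k) - F (x k)\<bar>) < \<epsilon> / 2"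
    using assms(1) \<open>\<epsilon> / 2 > 0\<close> unfolding AC_on_def by blast
  obtain d2 where d2: "d2 > 0" "\<And>(n::nat) x y. (\<forall>k<n. x k \<le> y k \<and> {x k..y k} \<subseteq> S) \<Longrightarrow>
     disjoint_family_on (\<lambda>k. {x k<..<y k}) {..<n} \<Longrightarrow>
     (\<Sum>k<n. y k - x k) < d2 \<Longrightarrow> (\<Sum>k<n. \<bar>G (y k) - G (x k)\<bar>) < \<epsilon> / 2"
    using assms(2) \<open>\<epsilon> / 2 > 0\<close> unfolding AC_on_def by blast
  show "\<exists>\<delta>>0. \<forall>(n::nat) x y. (\<forall>k<n. x k \<le> y k \<and> {x k..y k} \<subseteq> S) \<longrightarrow>
     disjoint_family_on (\<lambda>k. {x k<..<y k}) {..<n} \<longrightarrow>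
     (\<Sum>k<n. y k - x k) < \<delta> \<longrightarrow> (\<Sum>k<n. \<bar>(F (y k) - G (y k)) - (F (x k) - G (x k))\<bar>) < \<epsilon>"
  proof (intro exI[of _ "min d1 d2"] conjI allI impI)
    show "0 < min d1 d2" using d1(1) d2(1) by simp
    fix n :: nat and x y
    assume A: "\<forall>k<n. x k \<le> y k \<and> {x k..y k} \<subseteq> S" "disjoint_family_on (\<lambda>k. {x k<..<y k}) {..<n}"
      and s: "(\<Sum>k<n. y k - x k) < min d1 d2"
    have "(\<Sum>k<n. \<bar>(F (y k) - G (y k)) - (F (x k) - G (x k))\<bar>) \<le>
        (\<Sum>k<n. \<bar>F (y k) - F (x k)\<bar> + \<bar>G (y k) - G (x k)\<bar>)"
      by (intro sum_mono) linarith
    also have "\<dots> < \<epsilon>" using d1(2)[OF A] d2(2)[OF A] s by (simp add: sum.distrib)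
    finally show "(\<Sum>k<n. \<bar>(F (y k) - G (y k)) - (F (x k) - G (x k))\<bar>) < \<epsilon>" .
  qed
qed

lemma AC_on_cong:
  assumes F: "F \<in> AC_on S" and eq: "\<And>t. t \<in> S \<Longrightarrow> G t = F t"
  shows "G \<in> AC_on S"
  unfolding AC_on_def
proof (intro CollectI allI impI)
  fix \<epsilon> :: real assume "\<epsilon> > 0"
  then obtain d where d: "d > 0" "\<And>(n::nat) x y. (\<forall>k<n. x k \<le> y k \<and> {x k..y k} \<subseteq> S) \<Longrightarrow>
     disjoint_family_on (\<lambda>k. {x k<..<y k}) {..<n} \<Longrightarrow>
     (\<Sum>k<n. y k - x k) < d \<Longrightarrow> (\<Sum>k<n. \<bar>F (y k) - F (x k)\<bar>) < \<epsilon>"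
    using F unfolding AC_on_def by blast
  show "\<exists>\<delta>>0. \<forall>(n::nat) x y. (\<forall>k<n. x k \<le> y k \<and> {x k..y k} \<subseteq> S) \<longrightarrow>
     disjoint_family_on (\<lambda>k. {x k<..<y k}) {..<n} \<longrightarrow>
     (\<Sum>k<n. y k - x k) < \<delta> \<longrightarrow> (\<Sum>k<n. \<bar>G (y k) - G (x k)\<bar>) < \<epsilon>"
  proof (intro exI[of _ d] conjI allI impI)
    show "0 < d" by (rule d(1))
    fix n :: nat and x y
    assume A: "\<forall>k<n. x k \<le> y k \<and> {x k..y k} \<subseteq> S" "disjoint_family_on (\<lambda>k. {x k<..<y k}) {..<n}"
      "(\<Sum>k<n. y k - x k) < d"
    have "(\<Sum>k<n. \<bar>G (y k) - G (x k)\<bar>) = (\<Sum>k<n. \<bar>F (y k) - F (x k)\<bar>)"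
    proof (rule sum.cong[OF refl])
      fix k assume "k \<in> {..<n}"
      then have xy: "x k \<le> y k" "{x k..y k} \<subseteq> S" using A(1) by auto
      have "x k \<in> {x k..y k}" "y k \<in> {x k..y k}" using xy(1) by auto
      then have "x k \<in> S" "y k \<in> S" using xy(2) by blast+
      then show "\<bar>G (y k) - G (x k)\<bar> = \<bar>F (y k) - F (x k)\<bar>" by (simp only: eq)
    qed
    also have "\<dots> < \<epsilon>" by (rule d(2)[OF A])
    finally show "(\<Sum>k<n. \<bar>G (y k) - G (x k)\<bar>) < \<epsilon>" .
  qed
qed

lemma AE_has_derivative_integral_intervals_from:
  fixes g :: "real \<Rightarrow> real"
  assumes I: "I \<in> intervals_from a" and int: "\<And>b. b \<in> I \<Longrightarrow> g integrable_on {a..b}"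
  shows "AE t in lebesgue_on I. ((\<lambda>u. integral {a..u} g) has_real_derivative g t) (at t within I)"
proof -
  obtain B where B: "countable B" "B \<subseteq> I"
    "\<And>t. t \<in> I \<Longrightarrow> \<exists>b\<in>B. t \<le> b \<and> at t within I = at t within {a..b}"
    using intervals_from_exhaustion[OF I] by blast
  have "\<exists>N. negligible N \<and> (\<forall>t\<in>{a..b} - N. ((\<lambda>u. integral {a..u} g) has_real_derivative g t) (at t within {a..b}))"
    if "b \<in> I" for b
    by (rule Lebesgue_differentiation_interval[OF int[OF that]])
  then obtain N where N: "\<And>b. b \<in> I \<Longrightarrow> negligible (N b)"
    "\<And>b t. b \<in> I \<Longrightarrow> t \<in> {a..b} - N b \<Longrightarrow> ((\<lambda>u. integral {a..u} g) has_real_derivative g t) (at t within {a..b})"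
    by metis
  have "negligible (\<Union>b\<in>B. N b)" using B(1,2) N(1) by (intro negligible_countable_Union) auto
  then have "(\<Union>b\<in>B. N b) \<in> null_sets lebesgue" by (simp add: negligible_iff_null_sets)
  then have "AE t in lebesgue. t \<notin> (\<Union>b\<in>B. N b)" by (rule AE_not_in)
  then have "AE t in lebesgue. t \<in> I \<longrightarrow> ((\<lambda>u. integral {a..u} g) has_real_derivative g t) (at t within I)"
  proof eventually_elim
    fix t assume n: "t \<notin> (\<Union>b\<in>B. N b)"
    show "t \<in> I \<longrightarrow> ((\<lambda>u. integral {a..u} g) has_real_derivative g t) (at t within I)"
    proof
      assume t: "t \<in> I"
      obtain b where b: "b \<in> B" "t \<le> b" "at t within I = at t within {a..b}" using B(3)[OF t] by blast
      then have "b \<in> I" "t \<in> {a..b} - N b" using B(2) n intervals_fromD(2)[OF I t] by auto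
      from N(2)[OF this] show "((\<lambda>u. integral {a..u} g) has_real_derivative g t) (at t within I)"
        using b(3) by simp
    qed
  qed
  then show ?thesis using intervals_fromD(5)[OF I] by (subst AE_restrict_space_iff) auto
qed

text \<open>\<open>RL_integral\<close> picks some continuous version; the raw integral of a
  continuous p is continuous itself, and two continuous versions agree on all of I, not only almost
  everywhere.\<close>

lemma RL_integral_eq_raw:
  assumes I: "I \<in> intervals_from a" and p: "continuous_on I p" and \<alpha>: "0 < \<alpha>" "\<alpha> \<le> 1" and t: "t \<in> I"
  shows "RL_integral a I (1 - \<alpha>) p t = RL_integral_raw a (1 - \<alpha>) p t"
proof -
  let ?R = "RL_integral_raw a (1 - \<alpha>) p"
  have cont: "continuous_on I ?R"
  proof (cases "\<alpha> = 1")
    case True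
    then have "?R = p" by (simp add: RL_integral_raw_def fun_eq_iff)
    with p show ?thesis by simp
  next
    case False
    show ?thesis
    proof (rule continuous_on_intervals_from[OF I])
      fix b assume "b \<in> I"
      then have "continuous_on {a..b} p"
        using p intervals_fromD(3)[OF I intervals_fromD(1)[OF I]] by (meson continuous_on_subset)
      then obtain M where "bounded_measurable_on a b M p" by (rule continuous_imp_bounded_measurable_on)
      then show "continuous_on {a..b} ?R"
        using \<alpha> False by (intro bounded_measurable_on.continuous_on_RL_integral_raw) auto
    qed
  qed
  have ex: "\<exists>G. continuous_version I ?R G" using cont by (auto simp: continuous_version_def)
  then have "continuous_version I ?R (RL_integral a I (1 - \<alpha>) p)"
    unfolding RL_integral_def by (simp add: someI_ex)
  then have "continuous_on I (RL_integral a I (1 - \<alpha>) p)"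
    "AE t in lebesgue_on I. ?R t = RL_integral a I (1 - \<alpha>) p t"
    by (auto simp: continuous_version_def)
  from continuous_AE_eq_imp_eq[OF I cont this t] show ?thesis by simp
qed

text \<open>Put G = \<open>I^(1-\<alpha>) p\<close> and F = \<open>I^1 g\<close>; both sides amount
  to G = F on I. From the differential form, G - F is absolutely continuous, has derivative 0 almost
  everywhere and vanishes at a. Conversely F is Lipschitz on compact subintervals, with derivative g
  almost everywhere. The inversion lemma exchanges G = F for p =
  \<open>I^\<alpha> g\<close>.\<close>

lemma Caputo_scalar_iff:
  assumes I: "I \<in> intervals_from a" and p: "continuous_on I p" "p a = 0" and \<alpha>: "0 < \<alpha>" "\<alpha> \<le> 1"
    and g: "\<And>b. b \<in> I \<Longrightarrow> \<exists>M. bounded_measurable_on a b M g"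
  shows "p \<in> RL_AC a I \<alpha> \<and> (AE t in lebesgue_on I. has_RL_derivative a I \<alpha> p (g t) t) \<longleftrightarrow>
         (\<forall>t\<in>I. p t = RL_integral_raw a \<alpha> g t)"
proof -
  note ID = intervals_fromD[OF I]
  let ?G = "RL_integral a I (1 - \<alpha>) p" and ?R = "RL_integral_raw a (1 - \<alpha>) p" and ?F = "\<lambda>t. integral {a..t} g"
  have G: "?G t = ?R t" if "t \<in> I" for t by (rule RL_integral_eq_raw[OF I p(1) \<alpha> that])
  have ptc: "continuous_on {a..b} p" if "b \<in> I" for b
    using p(1) ID(3)[OF ID(1) that] by (rule continuous_on_subset)
  have gint: "g integrable_on {a..b}" if "b \<in> I" for b
    using g[OF that] bounded_measurable_on.absolutely_integrable[of a b _ g b] set_lebesgue_integral_eq_integral(1)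
    by blast
  \<comment> \<open>The Hoelder estimate at order 1 is a Lipschitz estimate, with constant 2 *
    M.\<close>
  have FL: "\<exists>L\<ge>0. \<forall>s t. a \<le> s \<longrightarrow> s \<le> t \<longrightarrow> t \<le> b \<longrightarrow> \<bar>?F t - ?F s\<bar> \<le> L * (t - s)" if b: "b \<in> I" for b
  proof -
    obtain M where "bounded_measurable_on a b M g" using g[OF b] by blast
    then interpret bounded_measurable_on a b M g .
    obtain h where h: "h \<in> borel_measurable borel" "\<And>\<tau>. \<bar>h \<tau>\<bar> \<le> M" "\<And>\<tau>. \<tau> < a \<Longrightarrow> h \<tau> = 0"
      "\<And>\<alpha> t. 0 < \<alpha> \<Longrightarrow> t \<le> b \<Longrightarrow> RL_integral_raw a \<alpha> g t = RL_conv \<alpha> h t"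
      using Borel_version by blast
    have "\<bar>?F t - ?F s\<bar> \<le> 2 * M * (t - s)" if "a \<le> s" "s \<le> t" "t \<le> b" for s t
      using RL_conv_Hoelder[OF _ _ that(1,2) h(1-3), of 1] RL_integral_raw_1[of t] RL_integral_raw_1[of s] h(4)[of 1 t] h(4)[of 1 s] that
      by (simp add: Gamma_numeral)
    then show ?thesis using M_nonneg by (intro exI[of _ "2 * M"]) auto
  qed
  have AE_F: "AE t in lebesgue_on I. (?F has_real_derivative g t) (at t within I)"
    by (rule AE_has_derivative_integral_intervals_from[OF I gint])
  have F_AC: "?F \<in> AC_on {c..d}" if "{c..d} \<subseteq> I" for c d
  proof (cases "c \<le> d")
    case True
    then have "d \<in> I" "a \<le> c" using that ID(2) by auto
    obtain L where L: "L \<ge> 0" "\<forall>s t. a \<le> s \<longrightarrow> s \<le> t \<longrightarrow> t \<le> d \<longrightarrow> \<bar>?F t - ?F s\<bar> \<le> L * (t - s)"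
      using FL[OF \<open>d \<in> I\<close>] by blast
    show ?thesis
    proof (rule AC_on_Lipschitz[OF _ L(1)])
      fix s t assume "s \<in> {c..d}" "t \<in> {c..d}" "s \<le> t"
      then have "a \<le> s" "t \<le> d" using \<open>a \<le> c\<close> by auto
      then show "\<bar>?F t - ?F s\<bar> \<le> L * (t - s)" using L(2) \<open>s \<le> t\<close> by blast
    qed
  next
    case False
    show ?thesis by (rule AC_on_Lipschitz[of _ _ 0]) (use False in auto)
  qed
  have L1: "p \<in> L1_loc I"
    using p(1) by (auto simp: L1_loc_def intro!: absolutely_integrable_continuous_real intro: continuous_on_subset)
  have inv: "(\<forall>t\<in>{a..b}. ?R t = ?F t) \<longleftrightarrow> (\<forall>t\<in>{a..b}. p t = RL_integral_raw a \<alpha> g t)" if b: "b \<in> I" for b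
  proof -
    obtain M where M: "bounded_measurable_on a b M g" using g[OF b] by blast
    show ?thesis by (rule RL_integral_raw_inversion[OF M ptc[OF b] p(2) \<alpha> ID(2)[OF b]])
  qed
  have inv_I: "(\<forall>t\<in>I. ?R t = ?F t) \<longleftrightarrow> (\<forall>t\<in>I. p t = RL_integral_raw a \<alpha> g t)"
  proof -
    have pts: "(\<forall>t\<in>I. Q t) \<longleftrightarrow> (\<forall>b\<in>I. \<forall>t\<in>{a..b}. Q t)" for Q :: "real \<Rightarrow> bool"
    proof (intro iffI ballI)
      fix b t assume "\<forall>t\<in>I. Q t" "b \<in> I" "t \<in> {a..b}"
      then show "Q t" using subsetD[OF ID(3)[OF ID(1) \<open>b \<in> I\<close>]] by blast
    next
      fix t assume "\<forall>b\<in>I. \<forall>t\<in>{a..b}. Q t" "t \<in> I"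
      then show "Q t" using ID(2)[OF \<open>t \<in> I\<close>] by simp
    qed
    have "(\<forall>t\<in>I. ?R t = ?F t) \<longleftrightarrow> (\<forall>b\<in>I. \<forall>t\<in>{a..b}. ?R t = ?F t)" by (rule pts)
    also have "\<dots> \<longleftrightarrow> (\<forall>b\<in>I. \<forall>t\<in>{a..b}. p t = RL_integral_raw a \<alpha> g t)" by (rule ball_cong[OF refl inv])
    also have "\<dots> \<longleftrightarrow> (\<forall>t\<in>I. p t = RL_integral_raw a \<alpha> g t)" by (rule pts[symmetric])
    finally show ?thesis .
  qed
  show ?thesis
  proof
    assume "p \<in> RL_AC a I \<alpha> \<and> (AE t in lebesgue_on I. has_RL_derivative a I \<alpha> p (g t) t)"
    then have AC: "?G \<in> AC_loc I" and der: "AE t in lebesgue_on I. (?G has_real_derivative g t) (at t within I)"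
      by (auto simp: RL_AC_def has_RL_derivative_def)
    have d0: "AE t in lebesgue_on I. ((\<lambda>t. ?G t - ?F t) has_real_derivative 0) (at t within I)"
      using der AE_F
    proof eventually_elim
      fix t assume "(?G has_real_derivative g t) (at t within I)" "(?F has_real_derivative g t) (at t within I)"
      from DERIV_diff[OF this] show "((\<lambda>t. ?G t - ?F t) has_real_derivative 0) (at t within I)" by simp
    qed
    then have "AE t in lebesgue. t \<in> I \<longrightarrow> ((\<lambda>t. ?G t - ?F t) has_real_derivative 0) (at t within I)"
      using ID(5) by (subst (asm) AE_restrict_space_iff) auto
    from AE_lebesgueD[OF this] obtain N where N: "N \<in> null_sets lebesgue"
      "\<forall>t. t \<notin> N \<longrightarrow> t \<in> I \<longrightarrow> ((\<lambda>t. ?G t - ?F t) has_real_derivative 0) (at t within I)"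
      by blast
    have "?R t = ?F t" if t: "t \<in> I" for t
    proof -
      have sub: "{a..t} \<subseteq> I" by (rule ID(3)[OF ID(1) t])
      have "?G t - ?F t = ?G a - ?F a"
      proof (rule AC_on_zero_derivative_imp_eq[where F = "\<lambda>t. ?G t - ?F t" and N = N])
        show "(\<lambda>t. ?G t - ?F t) \<in> AC_on {a..t}"
          using AC sub by (intro AC_on_diff F_AC) (simp_all add: AC_loc_def)
        show "a \<le> t" using ID(2)[OF t] .
        show "negligible N" using N(1) by (simp add: negligible_iff_null_sets)
        fix s assume s: "s \<in> {a..t} - N"
        then have "((\<lambda>t. ?G t - ?F t) has_real_derivative 0) (at s within I)" using N(2) sub by blast
        then show "((\<lambda>t. ?G t - ?F t) has_real_derivative 0) (at s within {a..t})"
          using sub by (rule DERIV_subset)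
      qed
      \<comment> \<open>For \<alpha> = 1 this is p a = 0, otherwise an integral over a single
        point.\<close>
      moreover have "?G a = 0"
      proof (cases "\<alpha> = 1")
        case True
        then show ?thesis using G[OF ID(1)] p(2) by (simp add: RL_integral_raw_def)
      next
        case False
        obtain M where "bounded_measurable_on a a M p"
          using continuous_imp_bounded_measurable_on[OF ptc[OF ID(1)]] by blast
        then show ?thesis
          using bounded_measurable_on.RL_integral_raw_at_left[of a a M p "1 - \<alpha>"] False \<alpha> G[OF ID(1)] by simp
      qed
      ultimately show ?thesis using G[OF t] by simp
    qed
    then show "\<forall>t\<in>I. p t = RL_integral_raw a \<alpha> g t" using inv_I by blast
  next
    assume "\<forall>t\<in>I. p t = RL_integral_raw a \<alpha> g t"
    then have "\<forall>t\<in>I. ?R t = ?F t" using inv_I by blast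
    then have GF: "?G t = ?F t" if "t \<in> I" for t using G that by simp
    have "?G \<in> AC_on {c..d}" if "{c..d} \<subseteq> I" for c d
      by (rule AC_on_cong[OF F_AC[OF that] GF[OF subsetD[OF that]]])
    then have "p \<in> RL_AC a I \<alpha>" using L1 by (auto simp: RL_AC_def AC_loc_def)
    moreover have "AE t in lebesgue_on I. has_RL_derivative a I \<alpha> p (g t) t"
      using AE_F AE_space
    proof eventually_elim
      fix t assume d: "(?F has_real_derivative g t) (at t within I)" and "t \<in> space (lebesgue_on I)"
      then have "t \<in> I" by simp
      show "has_RL_derivative a I \<alpha> p (g t) t"
        unfolding has_RL_derivative_def
        by (rule has_field_derivative_transform_within[OF d zero_less_one \<open>t \<in> I\<close>]) (use GF in simp)
    qed
    ultimately show "p \<in> RL_AC a I \<alpha> \<and> (AE t in lebesgue_on I. has_RL_derivative a I \<alpha> p (g t) t)" by blast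
  qed
qed

section \<open>Measurability of the right-hand side along a continuous function\<close>

text \<open>Replacing q by step functions, f(q(t), t) is pieced together from countably many
  measurable sections f(x, .); continuity of f in x passes to the limit.\<close>

lemma Caratheodory_superposition_measurable:
  fixes f :: "real ^ 'm \<Rightarrow> real \<Rightarrow> real ^ 'm"
  assumes f: "Caratheodory \<Omega> J f" and J: "J \<in> sets lebesgue" and I: "I \<in> intervals_from a" "I \<subseteq> J"
    and q: "continuous_on I q" "q ` I \<subseteq> \<Omega>"
  shows "(\<lambda>\<tau>. f (q \<tau>) \<tau>) \<in> borel_measurable (lebesgue_on I)"
proof -
  note ID = intervals_fromD[OF I(1)]
  have "AE t in lebesgue. t \<in> J \<longrightarrow> continuous_on \<Omega> (\<lambda>x. f x t)"
    using f J by (subst (asm) Caratheodory_def) (auto simp: AE_restrict_space_iff)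
  from AE_lebesgueD[OF this] obtain N where N: "N \<in> null_sets lebesgue"
    "\<And>t. t \<in> J \<Longrightarrow> t \<notin> N \<Longrightarrow> continuous_on \<Omega> (\<lambda>x. f x t)"
    by blast
  \<comment> \<open>Rounding \<tau> down to the grid of mesh 1/(n+1) and clipping at a keeps the
    point between a and \<tau>, hence inside I; rounding up could leave I on the right.\<close>
  define s where "s n k = max a (real_of_int k / real (Suc n))" for n k
  define w where "w n \<tau> = s n \<lfloor>real (Suc n) * \<tau>\<rfloor>" for n \<tau>
  have w: "w n \<tau> \<in> I" "dist (w n \<tau>) \<tau> \<le> 1 / real (Suc n)" if "\<tau> \<in> I" for n \<tau>
  proof -
    have fl: "real_of_int \<lfloor>real (Suc n) * \<tau>\<rfloor> \<le> real (Suc n) * \<tau>" "real (Suc n) * \<tau> < real_of_int \<lfloor>real (Suc n) * \<tau>\<rfloor> + 1"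
      by linarith+
    let ?k = "real_of_int \<lfloor>real (Suc n) * \<tau>\<rfloor>"
    have "?k / real (Suc n) \<le> \<tau>" "\<tau> - 1 / real (Suc n) \<le> ?k / real (Suc n)"
    proof -
      have "?k / real (Suc n) \<le> real (Suc n) * \<tau> / real (Suc n)"
        using fl(1) by (rule divide_right_mono) simp
      then show "?k / real (Suc n) \<le> \<tau>" by simp
      have "(real (Suc n) * \<tau> - 1) / real (Suc n) \<le> ?k / real (Suc n)"
        using fl(2) by (intro divide_right_mono) linarith+
      then show "\<tau> - 1 / real (Suc n) \<le> ?k / real (Suc n)" by (simp add: diff_divide_distrib)
    qed
    then have le: "w n \<tau> \<le> \<tau>" "\<tau> - 1 / real (Suc n) \<le> w n \<tau>" "a \<le> w n \<tau>"
      using ID(2)[OF that] by (auto simp: w_def s_def)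
    then show "w n \<tau> \<in> I" using ID(3)[OF ID(1) that] by auto
    show "dist (w n \<tau>) \<tau> \<le> 1 / real (Suc n)" using le by (simp add: dist_real_def)
  qed
  \<comment> \<open>The value 0 on the null set N makes \<open>F n\<close> converge to
    \<open>F0\<close> at every point.\<close>
  define F where "F n \<tau> = (if \<tau> \<in> N then 0 else if \<tau> \<in> I then f (q (w n \<tau>)) \<tau> else 0)" for n \<tau>
  define F0 where "F0 \<tau> = (if \<tau> \<in> N then 0 else if \<tau> \<in> I then f (q \<tau>) \<tau> else 0)" for \<tau>
  have [measurable]: "N \<in> sets lebesgue" using N(1) by auto
  have Fm: "F n \<in> borel_measurable lebesgue" for n
  proof -
    \<comment> \<open>For fixed k the grid point is constant, so \<phi> k is a cut-off section of f.
      Grid points outside I never arise from \<tau> in I and get the value 0.\<close>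
    define \<phi> where "\<phi> k \<tau> = (if \<tau> \<in> N then 0 else if s n k \<in> I then (if \<tau> \<in> I then f (q (s n k)) \<tau> else 0) else 0)" for k \<tau>
    have "\<phi> k \<in> borel_measurable lebesgue" for k
    proof (cases "s n k \<in> I")
      case True
      then have "f (q (s n k)) \<in> borel_measurable (lebesgue_on J)"
        using f q(2) by (auto simp: Caratheodory_def)
      then have "f (q (s n k)) \<in> borel_measurable (lebesgue_on I)"
        using I(2) by (rule measurable_restrict_mono)
      from borel_measurable_if_I[OF this ID(5)]
      have [measurable]: "(\<lambda>\<tau>. if \<tau> \<in> I then f (q (s n k)) \<tau> else 0) \<in> borel_measurable lebesgue" .
      show ?thesis unfolding \<phi>_def using True by simp
    next
      case False
      then have "\<phi> k = (\<lambda>\<tau>. 0)" by (auto simp: \<phi>_def)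
      then show ?thesis by simp
    qed
    moreover have "(\<lambda>\<tau>. \<lfloor>real (Suc n) * \<tau>\<rfloor>) \<in> measurable lebesgue (count_space UNIV)"
      by (intro measurable_completion) measurable
    ultimately have "(\<lambda>\<tau>. \<phi> \<lfloor>real (Suc n) * \<tau>\<rfloor> \<tau>) \<in> borel_measurable lebesgue"
      by (rule measurable_compose_countable'[where I=UNIV, OF _ _ countableI_type])
    also have "(\<lambda>\<tau>. \<phi> \<lfloor>real (Suc n) * \<tau>\<rfloor> \<tau>) = F n"
    proof
      fix \<tau>
      show "\<phi> \<lfloor>real (Suc n) * \<tau>\<rfloor> \<tau> = F n \<tau>"
      proof (cases "\<tau> \<in> I")
        case True
        have "s n \<lfloor>real (Suc n) * \<tau>\<rfloor> \<in> I" using w(1)[OF True, of n] unfolding w_def .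
        then show ?thesis unfolding \<phi>_def F_def w_def by (simp only: if_True)
      next
        case False
        then show ?thesis unfolding \<phi>_def F_def w_def by (simp only: if_False if_cancel)
      qed
    qed
    finally show ?thesis .
  qed
  have "F0 \<in> borel_measurable lebesgue"
  proof (rule borel_measurable_LIMSEQ_metric[OF Fm])
    fix \<tau>
    show "(\<lambda>n. F n \<tau>) \<longlonglongrightarrow> F0 \<tau>"
    proof (cases "\<tau> \<in> I \<and> \<tau> \<notin> N")
      case True
      have "(\<lambda>n. w n \<tau>) \<longlonglongrightarrow> \<tau>"
      proof (rule metric_tendsto_imp_tendsto[OF LIMSEQ_Suc[OF lim_1_over_n[where 'a=real]]])
        show "\<forall>\<^sub>F n in sequentially. dist (w n \<tau>) \<tau> \<le> dist (1 / real (Suc n)) 0"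
          using w(2)[of \<tau>] True by (simp add: dist_real_def)
      qed
      then have "(\<lambda>n. q (w n \<tau>)) \<longlonglongrightarrow> q \<tau>"
        using w(1) True by (intro continuous_on_tendsto_compose[OF q(1)] always_eventually) auto
      moreover have "continuous_on \<Omega> (\<lambda>x. f x \<tau>)" using N(2) True I(2) by auto
      ultimately have "(\<lambda>n. f (q (w n \<tau>)) \<tau>) \<longlonglongrightarrow> f (q \<tau>) \<tau>"
        using q(2) w(1) True by (intro continuous_on_tendsto_compose[where f="\<lambda>x. f x \<tau>"] always_eventually) auto
      then show ?thesis using True by (simp add: F_def F0_def)
    next
      case False
      then have "F n \<tau> = F0 \<tau>" for n
        unfolding F_def F0_def by (cases "\<tau> \<in> N") simp_all
      then show ?thesis by simp
    qed
  qed
  moreover have "AE \<tau> in lebesgue. F0 \<tau> = (if \<tau> \<in> I then f (q \<tau>) \<tau> else 0)"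
    using AE_not_in[OF N(1)] by eventually_elim (simp add: F0_def)
  ultimately have "(\<lambda>\<tau>. if \<tau> \<in> I then f (q \<tau>) \<tau> else 0) \<in> borel_measurable lebesgue"
    by (rule borel_measurable_AE)
  then show ?thesis by (rule borel_measurable_if_D)
qed

section \<open>The Cauchy problem\<close>

text \<open>The orders of the components may differ, but one length must serve them all. Each mass
  increases with s and reaches c at r i, and the minimum of the finitely many r i is
  positive.\<close>

lemma RL_kernel_mass_small:
  fixes \<alpha> :: "real ^ 'm"
  assumes \<alpha>: "\<And>i. 0 < \<alpha> $ i" and "0 < c"
  shows "\<exists>h>0. \<forall>i. \<forall>s. 0 \<le> s \<longrightarrow> s \<le> h \<longrightarrow> s powr (\<alpha> $ i) / Gamma (\<alpha> $ i + 1) \<le> c"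
proof -
  define r where "r i = (c * Gamma (\<alpha> $ i + 1)) powr (1 / \<alpha> $ i)" for i
  have G: "0 < Gamma (\<alpha> $ i + 1)" for i using \<alpha>[of i] by (intro Gamma_real_pos) simp
  have r: "0 < r i" for i using G[of i] \<open>0 < c\<close> by (simp add: r_def)
  define h where "h = Min (range r)"
  have "0 < h" unfolding h_def using r by (subst Min_gr_iff) auto
  moreover have "s powr (\<alpha> $ i) / Gamma (\<alpha> $ i + 1) \<le> c" if s: "0 \<le> s" "s \<le> h" for s i
  proof -
    have "h \<le> r i" unfolding h_def by (rule Min_le) auto
    then have "s powr (\<alpha> $ i) \<le> r i powr (\<alpha> $ i)"
      using s \<alpha>[of i] by (intro powr_mono2) auto
    also have "\<dots> = c * Gamma (\<alpha> $ i + 1)"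
      using \<alpha>[of i] G[of i] \<open>0 < c\<close> by (simp add: r_def powr_powr)
    finally show ?thesis using G[of i] by (simp add: pos_divide_le_eq)
  qed
  ultimately show ?thesis by (intro exI[of _ h]) simp
qed

lemma intervals_from_Icc: "a < b \<Longrightarrow> {a..b} \<in> intervals_from (a :: real)"
  by (auto simp: intervals_from_def is_interval_cc)

lemma AE_lebesgue_on_mono:
  assumes P: "AE t in lebesgue_on T. P t" and "S \<subseteq> T" and S: "S \<in> sets lebesgue" and T: "T \<in> sets lebesgue"
  shows "AE t in lebesgue_on S. P t"
proof -
  have "AE t in lebesgue. t \<in> T \<longrightarrow> P t" using P T by (subst (asm) AE_restrict_space_iff) auto
  then have "AE t in lebesgue. t \<in> S \<longrightarrow> P t" by eventually_elim (use \<open>S \<subseteq> T\<close> in blast)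
  then show ?thesis using S by (subst AE_restrict_space_iff) auto
qed

locale Caputo_Cauchy_problem =
  fixes a :: real and I\<^sub>f :: "real set" and \<Omega> :: "(real ^ 'm) set"
    and f :: "real ^ 'm \<Rightarrow> real \<Rightarrow> real ^ 'm" and q\<^sub>a \<alpha> :: "real ^ 'm"
  assumes I\<^sub>f: "I\<^sub>f \<in> intervals_from a"
    and Car: "Caratheodory \<Omega> I\<^sub>f f"
    and q\<^sub>a: "q\<^sub>a \<in> \<Omega>"
    and \<alpha>: "\<And>i. 0 < \<alpha> $ i \<and> \<alpha> $ i \<le> 1"
    and bounded_rhs: "\<And>K c d. compact K \<Longrightarrow> K \<subseteq> \<Omega> \<Longrightarrow> {c..d} \<subseteq> I\<^sub>f \<Longrightarrow>
           \<exists>M\<ge>0. \<forall>x\<in>K. AE t in lebesgue_on {c..d}. norm (f x t) \<le> M"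
    and Lipschitz_rhs: "\<And>x t. x \<in> \<Omega> \<Longrightarrow> t \<in> I\<^sub>f \<Longrightarrow>
           \<exists>R>0. \<exists>\<delta>>0. \<exists>L\<ge>0. cball x R \<subseteq> \<Omega> \<and>
             (\<forall>x1\<in>cball x R. \<forall>x2\<in>cball x R.
                AE \<tau> in lebesgue_on ({t - \<delta>..t + \<delta>} \<inter> I\<^sub>f).
                  norm (f x2 \<tau> - f x1 \<tau>) \<le> L * norm (x2 - x1))"
begin

definition rhs :: "(real \<Rightarrow> real ^ 'm) \<Rightarrow> 'm \<Rightarrow> real \<Rightarrow> real" where
  "rhs q i \<tau> = f (q \<tau>) \<tau> $ i"

text \<open>The equation is required at every t, with the raw integral instead of its continuous
  version: without exceptional set it can be glued. At t = a the integrals vanish, so it contains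
  the initial condition.\<close>

definition integral_solution :: "(real \<Rightarrow> real ^ 'm) \<Rightarrow> real set \<Rightarrow> bool" where
  "integral_solution q I \<longleftrightarrow> I \<in> intervals_from a \<and> I \<subseteq> I\<^sub>f \<and> continuous_on I q \<and> q ` I \<subseteq> \<Omega> \<and>
     (\<forall>t\<in>I. \<forall>i. q t $ i = q\<^sub>a $ i + RL_integral_raw a (\<alpha> $ i) (rhs q i) t)"

lemma \<alpha>_pos: "0 < \<alpha> $ i" and \<alpha>_le_1: "\<alpha> $ i \<le> 1"
  using \<alpha> by auto

section \<open>Null sets independent of the space variable\<close>

lemma AE_continuous_rhs:
  assumes "S \<subseteq> I\<^sub>f" "S \<in> sets lebesgue"
  shows "AE t in lebesgue_on S. continuous_on \<Omega> (\<lambda>x. f x t)"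
proof -
  have "AE t in lebesgue_on I\<^sub>f. continuous_on \<Omega> (\<lambda>x. f x t)"
    using Car unfolding Caratheodory_def by blast
  then show ?thesis using assms intervals_fromD(5)[OF I\<^sub>f] by (rule AE_lebesgue_on_mono)
qed

text \<open>The null set no longer depends on x, as the substitution x = q(t) demands.\<close>

lemma uniform_bound:
  assumes K: "compact K" "K \<subseteq> \<Omega>" and "{c..d} \<subseteq> I\<^sub>f"
  shows "\<exists>M\<ge>0. AE t in lebesgue_on {c..d}. \<forall>x\<in>K. norm (f x t) \<le> M"
proof -
  obtain M where M: "M \<ge> 0" "\<forall>x\<in>K. AE t in lebesgue_on {c..d}. norm (f x t) \<le> M"
    using bounded_rhs[OF assms] by blast
  have "AE t in lebesgue_on {c..d}. continuous_on K (\<lambda>x. norm (f x t))"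
  proof (rule eventually_mono)
    show "AE t in lebesgue_on {c..d}. continuous_on \<Omega> (\<lambda>x. f x t)"
      by (rule AE_continuous_rhs[OF assms(3)]) simp
    fix t assume "continuous_on \<Omega> (\<lambda>x. f x t)"
    then show "continuous_on K (\<lambda>x. norm (f x t))"
      by (intro continuous_on_norm) (rule continuous_on_subset[OF _ K(2)])
  qed
  then have "AE t in lebesgue_on {c..d}. \<forall>x\<in>K. norm (f x t) \<le> M"
    by (rule AE_ball_le_of_continuous) (use M(2) in blast)
  with M(1) show ?thesis by blast
qed

lemma uniform_Lipschitz:
  assumes x: "x \<in> \<Omega>" and t: "t \<in> I\<^sub>f"
  shows "\<exists>R>0. \<exists>\<delta>>0. \<exists>L\<ge>0. cball x R \<subseteq> \<Omega> \<and>
    (AE \<tau> in lebesgue_on ({t - \<delta>..t + \<delta>} \<inter> I\<^sub>f). \<forall>x1\<in>cball x R. \<forall>x2\<in>cball x R.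
       norm (f x2 \<tau> - f x1 \<tau>) \<le> L * norm (x2 - x1))"
proof -
  obtain R \<delta> L where R: "R > 0" "\<delta> > 0" "L \<ge> 0" "cball x R \<subseteq> \<Omega>"
    and L: "\<forall>x1\<in>cball x R. \<forall>x2\<in>cball x R. AE \<tau> in lebesgue_on ({t - \<delta>..t + \<delta>} \<inter> I\<^sub>f).
       norm (f x2 \<tau> - f x1 \<tau>) \<le> L * norm (x2 - x1)"
    using Lipschitz_rhs[OF x t] by (elim exE conjE) (rule that)
  let ?S = "{t - \<delta>..t + \<delta>} \<inter> I\<^sub>f" and ?K = "cball x R \<times> cball x R"
  \<comment> \<open>The pair (x1, x2) becomes one point of a product, and subtracting the right-hand
    side makes the bound the constant 0.\<close>
  let ?G = "\<lambda>p \<tau>. norm (f (snd p) \<tau> - f (fst p) \<tau>) - L * norm (snd p - fst p)"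
  have S: "?S \<in> sets lebesgue" using intervals_fromD(5)[OF I\<^sub>f] by auto
  have "AE \<tau> in lebesgue_on ?S. continuous_on ?K (\<lambda>p. ?G p \<tau>)"
    using AE_continuous_rhs[OF Int_lower2 S]
  proof (rule eventually_mono)
    fix \<tau> assume c: "continuous_on \<Omega> (\<lambda>x. f x \<tau>)"
    have "continuous_on ?K (\<lambda>p. f (snd p) \<tau>)"
      by (rule continuous_on_compose2[OF c continuous_on_snd[OF continuous_on_id]]) (use R(4) in auto)
    moreover have "continuous_on ?K (\<lambda>p. f (fst p) \<tau>)"
      by (rule continuous_on_compose2[OF c continuous_on_fst[OF continuous_on_id]]) (use R(4) in auto)
    ultimately show "continuous_on ?K (\<lambda>p. ?G p \<tau>)"
      by (intro continuous_intros)
  qed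
  then have "AE \<tau> in lebesgue_on ?S. \<forall>p\<in>?K. ?G p \<tau> \<le> 0"
  proof (rule AE_ball_le_of_continuous)
    fix p assume "p \<in> ?K"
    then have "AE \<tau> in lebesgue_on ?S. norm (f (snd p) \<tau> - f (fst p) \<tau>) \<le> L * norm (snd p - fst p)"
      using L by (simp add: mem_Times_iff)
    then show "AE \<tau> in lebesgue_on ?S. ?G p \<tau> \<le> 0" by simp
  qed
  then have "AE \<tau> in lebesgue_on ?S. \<forall>x1\<in>cball x R. \<forall>x2\<in>cball x R.
       norm (f x2 \<tau> - f x1 \<tau>) \<le> L * norm (x2 - x1)"
  proof (rule eventually_mono)
    fix \<tau> assume A: "\<forall>p\<in>?K. ?G p \<tau> \<le> 0"
    show "\<forall>x1\<in>cball x R. \<forall>x2\<in>cball x R. norm (f x2 \<tau> - f x1 \<tau>) \<le> L * norm (x2 - x1)"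
    proof (intro ballI)
      fix x1 x2 assume "x1 \<in> cball x R" "x2 \<in> cball x R"
      then show "norm (f x2 \<tau> - f x1 \<tau>) \<le> L * norm (x2 - x1)"
        using bspec[OF A, of "(x1, x2)"] by simp
    qed
  qed
  then show ?thesis using R by blast
qed

section \<open>Equivalence with the integral equation\<close>

lemma rhs_measurable:
  assumes I: "I \<in> intervals_from a" "I \<subseteq> I\<^sub>f" and q: "continuous_on I q" "q ` I \<subseteq> \<Omega>"
  shows "rhs q i \<in> borel_measurable (lebesgue_on I)"
proof -
  have "(\<lambda>\<tau>. f (q \<tau>) \<tau>) \<in> borel_measurable (lebesgue_on I)"
    by (rule Caratheodory_superposition_measurable[OF Car intervals_fromD(5)[OF I\<^sub>f] I q])
  moreover have "(\<lambda>x::real^'m. x $ i) \<in> borel_measurable borel"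
    by (intro borel_measurable_continuous_onI continuous_intros)
  ultimately show ?thesis unfolding rhs_def by (rule measurable_compose)
qed

text \<open>M depends on K and not on q: with K a ball, all candidates in the fixed point argument
  share one bound.\<close>

lemma rhs_bounded_measurable:
  assumes I: "I \<in> intervals_from a" "I \<subseteq> I\<^sub>f" and q: "continuous_on I q" "q ` I \<subseteq> \<Omega>"
    and b: "b \<in> I" "q ` {a..b} \<subseteq> K" and M: "M \<ge> 0" "AE t in lebesgue_on {a..b}. \<forall>x\<in>K. norm (f x t) \<le> M"
  shows "bounded_measurable_on a b M (rhs q i)"
proof
  have sub: "{a..b} \<subseteq> I" by (rule intervals_fromD(3)[OF I(1) intervals_fromD(1)[OF I(1)] b(1)])
  show "rhs q i \<in> borel_measurable (lebesgue_on {a..b})"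
    using rhs_measurable[OF I q] sub by (rule measurable_restrict_mono)
  show "0 \<le> M" by fact
  have "AE t in lebesgue. t \<in> {a..b} \<longrightarrow> (\<forall>x\<in>K. norm (f x t) \<le> M)"
    using M(2) by (simp only: AE_lebesgue_on_interval_iff)
  then show "AE \<tau> in lebesgue_on {a..b}. \<bar>rhs q i \<tau>\<bar> \<le> M"
    unfolding AE_lebesgue_on_interval_iff
  proof (rule eventually_mono)
    fix t assume A: "t \<in> {a..b} \<longrightarrow> (\<forall>x\<in>K. norm (f x t) \<le> M)"
    show "t \<in> {a..b} \<longrightarrow> \<bar>rhs q i t\<bar> \<le> M"
    proof
      assume "t \<in> {a..b}"
      then have "norm (f (q t) t) \<le> M" using A b(2) by blast
      then show "\<bar>rhs q i t\<bar> \<le> M" unfolding rhs_def by (rule norm_bound_component_le_cart)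
    qed
  qed
qed

lemma ex_rhs_bounded_measurable:
  assumes I: "I \<in> intervals_from a" "I \<subseteq> I\<^sub>f" and q: "continuous_on I q" "q ` I \<subseteq> \<Omega>" and b: "b \<in> I"
  shows "\<exists>M. bounded_measurable_on a b M (rhs q i)"
proof -
  have sub: "{a..b} \<subseteq> I" by (rule intervals_fromD(3)[OF I(1) intervals_fromD(1)[OF I(1)] b(1)])
  have "compact (q ` {a..b})"
    by (rule compact_continuous_image[OF continuous_on_subset[OF q(1) sub] compact_Icc])
  moreover have "q ` {a..b} \<subseteq> \<Omega>" using sub q(2) by blast
  ultimately obtain M where M: "M \<ge> 0" "AE t in lebesgue_on {a..b}. \<forall>x\<in>q ` {a..b}. norm (f x t) \<le> M"
    using uniform_bound[of "q ` {a..b}" a b] sub I(2) by blast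
  show ?thesis by (rule exI, rule rhs_bounded_measurable[OF I q b order_refl M])
qed

lemma integral_solution_at_left:
  assumes "integral_solution q I"
  shows "q a = q\<^sub>a"
proof -
  have I: "I \<in> intervals_from a" "I \<subseteq> I\<^sub>f" and q: "continuous_on I q" "q ` I \<subseteq> \<Omega>"
    and eq: "\<forall>t\<in>I. \<forall>i. q t $ i = q\<^sub>a $ i + RL_integral_raw a (\<alpha> $ i) (rhs q i) t"
    using assms unfolding integral_solution_def by auto
  have aI: "a \<in> I" by (rule intervals_fromD(1)[OF I(1)])
  have "q a $ i = q\<^sub>a $ i" for i
  proof -
    obtain M where "bounded_measurable_on a a M (rhs q i)"
      using ex_rhs_bounded_measurable[OF I q aI] by blast
    then have "RL_integral_raw a (\<alpha> $ i) (rhs q i) a = 0"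
      using \<alpha>_pos by (intro bounded_measurable_on.RL_integral_raw_at_left) auto
    then show ?thesis using eq aI by simp
  qed
  then show ?thesis by (simp add: vec_eq_iff)
qed

lemma local_solution_iff:
  "local_solution a I\<^sub>f \<Omega> f \<alpha> q\<^sub>a q I \<longleftrightarrow> integral_solution q I"
proof -
  have key: "(\<forall>i. (\<lambda>s. q s $ i - q a $ i) \<in> RL_AC a I (\<alpha> $ i)) \<and>
      (AE t in lebesgue_on I. has_Caputo_derivative a I \<alpha> q (f (q t) t) t) \<longleftrightarrow>
      (\<forall>t\<in>I. \<forall>i. q t $ i - q a $ i = RL_integral_raw a (\<alpha> $ i) (rhs q i) t)"
    if I: "I \<in> intervals_from a" "I \<subseteq> I\<^sub>f" and q: "continuous_on I q" "q ` I \<subseteq> \<Omega>"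
  proof -
    \<comment> \<open>The index type is finite, so "almost everywhere" and "for every component"
      commute.\<close>
    have AE_all: "(AE t in lebesgue_on I. has_Caputo_derivative a I \<alpha> q (f (q t) t) t) \<longleftrightarrow>
      (\<forall>i. AE t in lebesgue_on I. has_RL_derivative a I (\<alpha> $ i) (\<lambda>s. q s $ i - q a $ i) (rhs q i t) t)"
      unfolding has_Caputo_derivative_def rhs_def by (rule AE_all_countable)
    have comp: "(\<lambda>s. q s $ i - q a $ i) \<in> RL_AC a I (\<alpha> $ i) \<and>
      (AE t in lebesgue_on I. has_RL_derivative a I (\<alpha> $ i) (\<lambda>s. q s $ i - q a $ i) (rhs q i t) t) \<longleftrightarrow>
      (\<forall>t\<in>I. q t $ i - q a $ i = RL_integral_raw a (\<alpha> $ i) (rhs q i) t)" for i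
      by (rule Caputo_scalar_iff[OF I(1) _ _ \<alpha>_pos \<alpha>_le_1 ex_rhs_bounded_measurable[OF I q]])
        (use q(1) in \<open>auto intro!: continuous_intros\<close>)
    show ?thesis unfolding AE_all all_conj_distrib[symmetric] comp by blast
  qed
  show ?thesis
  proof
    assume "local_solution a I\<^sub>f \<Omega> f \<alpha> q\<^sub>a q I"
    then have I: "I \<in> intervals_from a" "I \<subseteq> I\<^sub>f" and q: "continuous_on I q" "q ` I \<subseteq> \<Omega>" and "q a = q\<^sub>a"
      and "\<forall>i. (\<lambda>s. q s $ i - q a $ i) \<in> RL_AC a I (\<alpha> $ i)"
      "AE t in lebesgue_on I. has_Caputo_derivative a I \<alpha> q (f (q t) t) t"
      unfolding local_solution_def Caputo_AC_def by auto
    then have "\<forall>t\<in>I. \<forall>i. q t $ i - q\<^sub>a $ i = RL_integral_raw a (\<alpha> $ i) (rhs q i) t"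
      using key[OF I q] by simp
    then have "\<forall>t\<in>I. \<forall>i. q t $ i = q\<^sub>a $ i + RL_integral_raw a (\<alpha> $ i) (rhs q i) t"
      by (simp add: diff_eq_eq add.commute)
    with I q show "integral_solution q I" unfolding integral_solution_def by blast
  next
    assume s: "integral_solution q I"
    then have I: "I \<in> intervals_from a" "I \<subseteq> I\<^sub>f" and q: "continuous_on I q" "q ` I \<subseteq> \<Omega>"
      and eq: "\<forall>t\<in>I. \<forall>i. q t $ i = q\<^sub>a $ i + RL_integral_raw a (\<alpha> $ i) (rhs q i) t"
      unfolding integral_solution_def by auto
    note qa = integral_solution_at_left[OF s]
    have "\<forall>t\<in>I. \<forall>i. q t $ i - q a $ i = RL_integral_raw a (\<alpha> $ i) (rhs q i) t"
      using eq unfolding qa by simp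
    then have "(\<forall>i. (\<lambda>s. q s $ i - q a $ i) \<in> RL_AC a I (\<alpha> $ i))"
      "AE t in lebesgue_on I. has_Caputo_derivative a I \<alpha> q (f (q t) t) t"
      using key[OF I q] by auto
    with I q qa show "local_solution a I\<^sub>f \<Omega> f \<alpha> q\<^sub>a q I"
      unfolding local_solution_def Caputo_AC_def by blast
  qed
qed

section \<open>Uniqueness\<close>

text \<open>Shared by uniqueness, with T the point of separation, and by the contraction estimate,
  with T = a. On [a, T) the right-hand sides cancel, so the memory contributes nothing; on [T, b]
  their difference is at most L * D almost everywhere.\<close>

lemma RL_integral_rhs_diff_le:
  assumes I1: "I1 \<in> intervals_from a" "I1 \<subseteq> I\<^sub>f" "continuous_on I1 q1" "q1 ` I1 \<subseteq> \<Omega>" "b \<in> I1"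
    and I2: "I2 \<in> intervals_from a" "I2 \<subseteq> I\<^sub>f" "continuous_on I2 q2" "q2 ` I2 \<subseteq> \<Omega>" "b \<in> I2"
    and T: "a \<le> T" "T \<le> t" "t \<le> b" and eq: "\<And>\<tau>. a \<le> \<tau> \<Longrightarrow> \<tau> < T \<Longrightarrow> q1 \<tau> = q2 \<tau>"
    and B: "\<And>\<tau>. \<tau> \<in> {T..b} \<Longrightarrow> q1 \<tau> \<in> B" "\<And>\<tau>. \<tau> \<in> {T..b} \<Longrightarrow> q2 \<tau> \<in> B"
    and L: "0 \<le> L" "AE \<tau> in lebesgue_on {T..b}. \<forall>x1\<in>B. \<forall>x2\<in>B. norm (f x2 \<tau> - f x1 \<tau>) \<le> L * norm (x2 - x1)"
    and D: "0 \<le> D" "\<And>\<tau>. \<tau> \<in> {T..b} \<Longrightarrow> norm (q1 \<tau> - q2 \<tau>) \<le> D"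
  shows "\<bar>RL_integral_raw a (\<alpha> $ i) (rhs q1 i) t - RL_integral_raw a (\<alpha> $ i) (rhs q2 i) t\<bar>
      \<le> L * D * ((t - T) powr (\<alpha> $ i) / Gamma (\<alpha> $ i + 1))"
proof -
  obtain M1 where M1: "bounded_measurable_on a b M1 (rhs q1 i)" using ex_rhs_bounded_measurable[OF I1] by blast
  obtain M2 where M2: "bounded_measurable_on a b M2 (rhs q2 i)" using ex_rhs_bounded_measurable[OF I2] by blast
  have bm: "bounded_measurable_on a b (L * D) (\<lambda>\<tau>. rhs q1 i \<tau> - rhs q2 i \<tau>)"
  proof
    show "(\<lambda>\<tau>. rhs q1 i \<tau> - rhs q2 i \<tau>) \<in> borel_measurable (lebesgue_on {a..b})"
      using bounded_measurable_on.meas[OF M1] bounded_measurable_on.meas[OF M2] by (rule borel_measurable_diff)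
    show "0 \<le> L * D" using L(1) D(1) by simp
    have "AE \<tau> in lebesgue. \<tau> \<in> {T..b} \<longrightarrow> (\<forall>x1\<in>B. \<forall>x2\<in>B. norm (f x2 \<tau> - f x1 \<tau>) \<le> L * norm (x2 - x1))"
      using L(2) by (simp only: AE_lebesgue_on_interval_iff)
    then show "AE \<tau> in lebesgue_on {a..b}. \<bar>rhs q1 i \<tau> - rhs q2 i \<tau>\<bar> \<le> L * D"
      unfolding AE_lebesgue_on_interval_iff
    proof (rule eventually_mono)
      fix \<tau> assume A: "\<tau> \<in> {T..b} \<longrightarrow> (\<forall>x1\<in>B. \<forall>x2\<in>B. norm (f x2 \<tau> - f x1 \<tau>) \<le> L * norm (x2 - x1))"
      show "\<tau> \<in> {a..b} \<longrightarrow> \<bar>rhs q1 i \<tau> - rhs q2 i \<tau>\<bar> \<le> L * D"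
      proof
        assume \<tau>: "\<tau> \<in> {a..b}"
        show "\<bar>rhs q1 i \<tau> - rhs q2 i \<tau>\<bar> \<le> L * D"
        proof (cases "\<tau> < T")
          case True
          then show ?thesis using eq[of \<tau>] \<tau> L(1) D(1) by (simp add: rhs_def)
        next
          case False
          then have "\<tau> \<in> {T..b}" using \<tau> by simp
          then have "norm (f (q1 \<tau>) \<tau> - f (q2 \<tau>) \<tau>) \<le> L * norm (q1 \<tau> - q2 \<tau>)"
            using A B by blast
          also have "\<dots> \<le> L * D" using D(2)[OF \<open>\<tau> \<in> {T..b}\<close>] L(1) by (rule mult_left_mono)
          finally have "\<bar>(f (q1 \<tau>) \<tau> - f (q2 \<tau>) \<tau>) $ i\<bar> \<le> L * D" by (rule norm_bound_component_le_cart)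
          then show ?thesis by (simp add: rhs_def)
        qed
      qed
    qed
  qed
  have "\<bar>RL_integral_raw a (\<alpha> $ i) (\<lambda>\<tau>. rhs q1 i \<tau> - rhs q2 i \<tau>) t\<bar> \<le> L * D * ((t - T) powr (\<alpha> $ i) / Gamma (\<alpha> $ i + 1))"
    by (rule bounded_measurable_on.abs_RL_integral_raw_le[OF bm \<alpha>_pos T]) (simp add: rhs_def eq)
  then show ?thesis by (simp add: RL_integral_raw_diff[OF M1 M2 \<alpha>_pos T(3)])
qed

lemma integral_solution_unique:
  assumes s1: "integral_solution q1 I1" and s2: "integral_solution q2 I2" and t1: "t1 \<in> I1" "t1 \<in> I2"
  shows "q1 t1 = q2 t1"
proof (rule ccontr)
  assume ne: "q1 t1 \<noteq> q2 t1"
  have I1: "I1 \<in> intervals_from a" "I1 \<subseteq> I\<^sub>f" "continuous_on I1 q1" "q1 ` I1 \<subseteq> \<Omega>"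
    and eq1: "\<And>t i. t \<in> I1 \<Longrightarrow> q1 t $ i = q\<^sub>a $ i + RL_integral_raw a (\<alpha> $ i) (rhs q1 i) t"
    using s1 unfolding integral_solution_def by auto
  have I2: "I2 \<in> intervals_from a" "I2 \<subseteq> I\<^sub>f" "continuous_on I2 q2" "q2 ` I2 \<subseteq> \<Omega>"
    and eq2: "\<And>t i. t \<in> I2 \<Longrightarrow> q2 t $ i = q\<^sub>a $ i + RL_integral_raw a (\<alpha> $ i) (rhs q2 i) t"
    using s2 unfolding integral_solution_def by auto
  have at1: "a \<le> t1" by (rule intervals_fromD(2)[OF I1(1) t1(1)])
  have sub1: "{a..t1} \<subseteq> I1" by (rule intervals_fromD(3)[OF I1(1) intervals_fromD(1)[OF I1(1)] t1(1)])
  have sub2: "{a..t1} \<subseteq> I2" by (rule intervals_fromD(3)[OF I2(1) intervals_fromD(1)[OF I2(1)] t1(2)])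
  have c1: "continuous_on {a..t1} q1" by (rule continuous_on_subset[OF I1(3) sub1])
  have c2: "continuous_on {a..t1} q2" by (rule continuous_on_subset[OF I2(3) sub2])
  define S where "S = {t\<in>{a..t1}. q1 t \<noteq> q2 t}"
  have t1S: "t1 \<in> S" using ne at1 by (simp add: S_def)
  have bS: "bdd_below S" by (rule bdd_belowI[of _ a]) (simp add: S_def)
  define T where "T = Inf S"
  have aT: "a \<le> T" unfolding T_def by (rule cInf_greatest) (use t1S in \<open>auto simp: S_def\<close>)
  have Tt1: "T \<le> t1" unfolding T_def by (rule cInf_lower[OF t1S bS])
  have before: "q1 \<tau> = q2 \<tau>" if "a \<le> \<tau>" "\<tau> < T" for \<tau>
  proof (rule ccontr)
    assume "q1 \<tau> \<noteq> q2 \<tau>"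
    then have "\<tau> \<in> S" using that Tt1 by (simp add: S_def)
    then have "T \<le> \<tau>" unfolding T_def by (rule cInf_lower[OF _ bS])
    then show False using that by simp
  qed
  have Tm: "T \<in> {a..t1}" using aT Tt1 by simp
  \<comment> \<open>Continuity from the left carries the equality to T, unless T = a, where both
    start at \<open>q\<^sub>a\<close>.\<close>
  have eqT: "q1 T = q2 T"
  proof (cases "T = a")
    case True
    then show ?thesis using integral_solution_at_left[OF s1] integral_solution_at_left[OF s2] by simp
  next
    case False
    then have "a < T" using aT by simp
    have "continuous_on {a..T} (\<lambda>t. q1 t - q2 t)"
      using continuous_on_subset[OF c1, of "{a..T}"] continuous_on_subset[OF c2, of "{a..T}"] Tt1
      by (intro continuous_on_diff) auto
    moreover have "closure {a..<T} = {a..T}" using \<open>a < T\<close> by (rule closure_atLeastLessThan)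
    ultimately have "q1 T - q2 T = 0"
      using continuous_constant_on_closure[of "{a..<T}" "\<lambda>t. q1 t - q2 t" 0 T] before \<open>a < T\<close> by simp
    then show ?thesis by simp
  qed
  have "T < t1" using eqT ne Tt1 by (cases "T = t1") auto
  have xO: "q1 T \<in> \<Omega>" using I1(4) sub1 Tm by blast
  have TI: "T \<in> I\<^sub>f" using I1(2) sub1 Tm by blast
  obtain R \<delta> L where R: "R > 0" "\<delta> > 0" "L \<ge> 0" "cball (q1 T) R \<subseteq> \<Omega>"
    and L: "AE \<tau> in lebesgue_on ({T - \<delta>..T + \<delta>} \<inter> I\<^sub>f). \<forall>x1\<in>cball (q1 T) R. \<forall>x2\<in>cball (q1 T) R.
       norm (f x2 \<tau> - f x1 \<tau>) \<le> L * norm (x2 - x1)"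
    using uniform_Lipschitz[OF xO TI] by (elim exE conjE) (rule that)
  obtain e1 where e1: "e1 > 0" "\<forall>s\<in>{a..t1}. dist s T < e1 \<longrightarrow> dist (q1 s) (q1 T) < R"
    using c1 Tm R(1) unfolding continuous_on_iff by metis
  obtain e2 where e2: "e2 > 0" "\<forall>s\<in>{a..t1}. dist s T < e2 \<longrightarrow> dist (q2 s) (q2 T) < R"
    using c2 Tm R(1) unfolding continuous_on_iff by metis
  let ?m = "real CARD('m)"
  have m: "0 < ?m" by simp
  \<comment> \<open>The Euclidean norm is at most the sum of the \<open>?m\<close> components, each
    at most L * D * c; this c makes the sum at most D / 2. L + 1 avoids a division by 0.\<close>
  define c where "c = 1 / (2 * (L + 1) * ?m)"
  have c: "0 < c" using R(3) m by (simp add: c_def)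
  obtain h where h: "h > 0" "\<forall>i. \<forall>s. 0 \<le> s \<longrightarrow> s \<le> h \<longrightarrow> s powr (\<alpha> $ i) / Gamma (\<alpha> $ i + 1) \<le> c"
    using RL_kernel_mass_small[of \<alpha>, OF \<alpha>_pos c] by blast
  \<comment> \<open>Up to b both solutions stay in the ball, the Lipschitz bound is valid and the
    kernel mass is at most c. Halving e1 and e2 makes those inequalities strict.\<close>
  define b where "b = min t1 (T + min (min (e1 / 2) (e2 / 2)) (min \<delta> h))"
  have b: "T < b" "b \<le> t1" "b - T < e1" "b - T < e2" "b - T \<le> \<delta>" "b - T \<le> h"
    using \<open>T < t1\<close> e1(1) e2(1) R(2) h(1) by (auto simp: b_def min_def)
  have bI: "b \<in> I1" "b \<in> I2" using sub1 sub2 b aT by auto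
  have sub: "{T..b} \<subseteq> {a..t1}" using aT b by auto
  have ball1: "q1 \<tau> \<in> cball (q1 T) R" if "\<tau> \<in> {T..b}" for \<tau>
  proof -
    have "\<tau> \<in> {a..t1}" "dist \<tau> T < e1" using sub that b(3) by (auto simp: dist_real_def)
    then have "dist (q1 \<tau>) (q1 T) < R" using e1(2) by blast
    then show ?thesis by (simp add: dist_commute)
  qed
  have ball2: "q2 \<tau> \<in> cball (q1 T) R" if "\<tau> \<in> {T..b}" for \<tau>
  proof -
    have "\<tau> \<in> {a..t1}" "dist \<tau> T < e2" using sub that b(4) by (auto simp: dist_real_def)
    then have "dist (q2 \<tau>) (q2 T) < R" using e2(2) by blast
    then show ?thesis by (simp add: eqT dist_commute)
  qed
  have "continuous_on {T..b} (\<lambda>t. norm (q1 t - q2 t))"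
    using continuous_on_subset[OF c1 sub] continuous_on_subset[OF c2 sub] by (intro continuous_intros)
  \<comment> \<open>The maximal difference D is attained at s0, so the estimate at s0 alone gives D
    \<le> D / 2.\<close>
  then obtain s0 where s0: "s0 \<in> {T..b}" "\<forall>t\<in>{T..b}. norm (q1 t - q2 t) \<le> norm (q1 s0 - q2 s0)"
    using continuous_attains_sup[of "{T..b}" "\<lambda>t. norm (q1 t - q2 t)"] b(1) by auto
  define D where "D = norm (q1 s0 - q2 s0)"
  have D: "0 \<le> D" "\<And>\<tau>. \<tau> \<in> {T..b} \<Longrightarrow> norm (q1 \<tau> - q2 \<tau>) \<le> D"
    using s0(2) by (auto simp: D_def)
  have LTb: "AE \<tau> in lebesgue_on {T..b}. \<forall>x1\<in>cball (q1 T) R. \<forall>x2\<in>cball (q1 T) R.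
       norm (f x2 \<tau> - f x1 \<tau>) \<le> L * norm (x2 - x1)"
  proof -
    have "{T..b} \<subseteq> I\<^sub>f" using sub sub1 I1(2) by (rule order_trans[OF order_trans])
    then have "{T..b} \<subseteq> {T - \<delta>..T + \<delta>} \<inter> I\<^sub>f" using b(5) R(2) by auto
    with L show ?thesis
      by (rule AE_lebesgue_on_mono) (use intervals_fromD(5)[OF I\<^sub>f] in auto)
  qed
  have comp: "\<bar>(q1 s0 - q2 s0) $ i\<bar> \<le> L * D * c" for i
  proof -
    have s0': "a \<le> T" "T \<le> s0" "s0 \<le> b" using aT s0(1) by auto
    have "\<bar>RL_integral_raw a (\<alpha> $ i) (rhs q1 i) s0 - RL_integral_raw a (\<alpha> $ i) (rhs q2 i) s0\<bar>
      \<le> L * D * ((s0 - T) powr (\<alpha> $ i) / Gamma (\<alpha> $ i + 1))"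
      by (rule RL_integral_rhs_diff_le[OF I1 bI(1) I2 bI(2) s0' before ball1 ball2 R(3) LTb D])
    also have "\<dots> \<le> L * D * c"
      using h(2) s0' b(6) R(3) D(1) by (intro mult_left_mono) auto
    finally show ?thesis using eq1[of s0 i] eq2[of s0 i] s0(1) sub sub1 sub2 by (simp add: subset_iff)
  qed
  have "D \<le> (\<Sum>i\<in>UNIV. \<bar>(q1 s0 - q2 s0) $ i\<bar>)" unfolding D_def by (rule norm_le_l1_cart)
  also have "\<dots> \<le> (\<Sum>i\<in>(UNIV::'m set). L * D * c)" by (rule sum_mono) (rule comp)
  also have "\<dots> = (L / (L + 1)) * (D / 2)" using R(3) m by (simp add: c_def)
  also have "\<dots> \<le> 1 * (D / 2)" using R(3) D(1) by (intro mult_right_mono) auto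
  finally have "D = 0" using D(1) by simp
  then have after: "q1 \<tau> = q2 \<tau>" if "\<tau> \<in> {T..b}" for \<tau> using D(2)[OF that] by simp
  have "b \<le> T"
    unfolding T_def
  proof (rule cInf_greatest)
    show "S \<noteq> {}" using t1S by blast
    fix s assume "s \<in> S"
    show "b \<le> s"
    proof (rule ccontr)
      assume "\<not> b \<le> s"
      then show False using \<open>s \<in> S\<close> before[of s] after[of s] by (cases "s < T") (auto simp: S_def)
    qed
  qed
  then show False using b(1) by simp
qed

section \<open>Local existence by a fixed point\<close>

lemma ex_integral_solution: "\<exists>q I. integral_solution q I"
proof -
  have aI: "a \<in> I\<^sub>f" by (rule intervals_fromD(1)[OF I\<^sub>f])
  obtain b0 where b0: "b0 \<in> I\<^sub>f" "a < b0" using intervals_fromD(4)[OF I\<^sub>f] by blast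
  have sub0: "{a..b0} \<subseteq> I\<^sub>f" by (rule intervals_fromD(3)[OF I\<^sub>f aI b0(1)])
  obtain R \<delta> L where R: "R > 0" "\<delta> > 0" "L \<ge> 0" "cball q\<^sub>a R \<subseteq> \<Omega>"
    and L: "AE \<tau> in lebesgue_on ({a - \<delta>..a + \<delta>} \<inter> I\<^sub>f). \<forall>x1\<in>cball q\<^sub>a R. \<forall>x2\<in>cball q\<^sub>a R.
       norm (f x2 \<tau> - f x1 \<tau>) \<le> L * norm (x2 - x1)"
    using uniform_Lipschitz[OF q\<^sub>a aI] by (elim exE conjE) (rule that)
  obtain M where M: "M \<ge> 0" "AE t in lebesgue_on {a..b0}. \<forall>x\<in>cball q\<^sub>a R. norm (f x t) \<le> M"
    using uniform_bound[OF compact_cball R(4) sub0] by blast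
  let ?m = "real CARD('m)"
  have m: "0 < ?m" by simp
  \<comment> \<open>The first term keeps the image in the ball of radius R: \<open>?m\<close>
    components of size at most M * c. The second yields the contraction factor 1/2.\<close>
  define c where "c = min (R / ((M + 1) * ?m)) (1 / (2 * (L + 1) * ?m))"
  have c: "0 < c" using R(1,3) M(1) m by (simp add: c_def)
  obtain h where h: "h > 0" "\<forall>i. \<forall>s. 0 \<le> s \<longrightarrow> s \<le> h \<longrightarrow> s powr (\<alpha> $ i) / Gamma (\<alpha> $ i + 1) \<le> c"
    using RL_kernel_mass_small[of \<alpha>, OF \<alpha>_pos c] by blast
  define b where "b = min b0 (a + min \<delta> h)"
  have b: "a < b" "b \<le> b0" "b - a \<le> \<delta>" "b - a \<le> h"
    using b0(2) R(2) h(1) by (auto simp: b_def min_def)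
  have sub: "{a..b} \<subseteq> I\<^sub>f" using sub0 b(2) by (intro order_trans[OF _ sub0]) auto
  have J: "{a..b} \<in> intervals_from a" by (rule intervals_from_Icc[OF b(1)])
  have bJ: "b \<in> {a..b}" using b(1) by simp
  have Mb: "AE t in lebesgue_on {a..b}. \<forall>x\<in>cball q\<^sub>a R. norm (f x t) \<le> M"
    using M(2) by (rule AE_lebesgue_on_mono) (use b(2) in auto)
  have Lb: "AE \<tau> in lebesgue_on {a..b}. \<forall>x1\<in>cball q\<^sub>a R. \<forall>x2\<in>cball q\<^sub>a R.
       norm (f x2 \<tau> - f x1 \<tau>) \<le> L * norm (x2 - x1)"
  proof -
    have "{a..b} \<subseteq> {a - \<delta>..a + \<delta>} \<inter> I\<^sub>f" using sub b(3) R(2) by auto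
    with L show ?thesis
      by (rule AE_lebesgue_on_mono) (use intervals_fromD(5)[OF I\<^sub>f] in auto)
  qed
  define \<Phi> where "\<Phi> q t = (\<chi> i. q\<^sub>a $ i + RL_integral_raw a (\<alpha> $ i) (rhs q i) t)" for q t
  \<comment> \<open>The fixed point is sought among bounded continuous functions on the whole line,
    so functions on [a, b] are extended by freezing the argument at the ends.\<close>
  define \<pi> where "\<pi> t = max a (min b t)" for t
  have \<pi>: "\<pi> t \<in> {a..b}" for t using b(1) by (auto simp: \<pi>_def)
  have \<pi>_id: "\<pi> t = t" if "t \<in> {a..b}" for t using that by (simp add: \<pi>_def)
  \<comment> \<open>Values in a closed ball at every real argument: a closed subset of a complete
    space.\<close>
  define X where "X = PiC UNIV (\<lambda>_::real. cball q\<^sub>a R)"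
  \<comment> \<open>\<open>Bcontfun\<close> is meaningful only for bounded continuous functions; for
    \<phi> in X this is established below.\<close>
  define \<Psi> where "\<Psi> \<phi> = Bcontfun (\<lambda>t. \<Phi> (apply_bcontfun \<phi>) (\<pi> t))" for \<phi>
  have X: "apply_bcontfun \<phi> t \<in> cball q\<^sub>a R" if "\<phi> \<in> X" for \<phi> t
    using that unfolding X_def mem_PiC_iff by auto
  have X\<Omega>: "apply_bcontfun \<phi> ` {a..b} \<subseteq> \<Omega>" if "\<phi> \<in> X" for \<phi>
    using X[OF that] R(4) by blast
  have bm: "bounded_measurable_on a b M (rhs (apply_bcontfun \<phi>) i)" if "\<phi> \<in> X" for \<phi> i
    by (rule rhs_bounded_measurable[OF J sub continuous_on_apply_bcontfun X\<Omega>[OF that] bJ _ M(1) Mb])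
      (use X[OF that] in blast)
  have ball: "\<Phi> (apply_bcontfun \<phi>) t \<in> cball q\<^sub>a R" if \<phi>: "\<phi> \<in> X" and t: "t \<in> {a..b}" for \<phi> t
  proof -
    have comp: "\<bar>(\<Phi> (apply_bcontfun \<phi>) t - q\<^sub>a) $ i\<bar> \<le> R / ?m" for i
    proof -
      have "\<bar>RL_integral_raw a (\<alpha> $ i) (rhs (apply_bcontfun \<phi>) i) t\<bar> \<le> M * ((t - a) powr (\<alpha> $ i) / Gamma (\<alpha> $ i + 1))"
        by (rule bounded_measurable_on.abs_RL_integral_raw_le[OF bm[OF \<phi>] \<alpha>_pos order_refl]) (use t in auto)
      also have "\<dots> \<le> M * c" using h(2) t b(4) M(1) by (intro mult_left_mono) auto
      also have "\<dots> \<le> (M + 1) * (R / ((M + 1) * ?m))" using M(1) c by (intro mult_mono) (auto simp: c_def)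
      also have "\<dots> = R / ?m" using M(1) by simp
      finally show ?thesis by (simp add: \<Phi>_def)
    qed
    have "norm (\<Phi> (apply_bcontfun \<phi>) t - q\<^sub>a) \<le> (\<Sum>i\<in>UNIV. \<bar>(\<Phi> (apply_bcontfun \<phi>) t - q\<^sub>a) $ i\<bar>)"
      by (rule norm_le_l1_cart)
    also have "\<dots> \<le> (\<Sum>i\<in>(UNIV::'m set). R / ?m)" by (rule sum_mono) (rule comp)
    also have "\<dots> = R" by simp
    finally show ?thesis by (simp add: dist_norm norm_minus_commute)
  qed
  have cont: "continuous_on {a..b} (\<Phi> (apply_bcontfun \<phi>))" if "\<phi> \<in> X" for \<phi>
  proof -
    have "continuous_on {a..b} (RL_integral_raw a (\<alpha> $ i) (rhs (apply_bcontfun \<phi>) i))" for i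
      by (rule bounded_measurable_on.continuous_on_RL_integral_raw[OF bm[OF that] \<alpha>_pos \<alpha>_le_1])
    then show ?thesis unfolding \<Phi>_def by (intro continuous_on_vec_lambda continuous_on_add continuous_on_const)
  qed
  have \<Psi>: "apply_bcontfun (\<Psi> \<phi>) = (\<lambda>t. \<Phi> (apply_bcontfun \<phi>) (\<pi> t))" if "\<phi> \<in> X" for \<phi>
  proof -
    have "continuous_on UNIV \<pi>" unfolding \<pi>_def by (intro continuous_intros)
    then have "continuous_on UNIV (\<lambda>t. \<Phi> (apply_bcontfun \<phi>) (\<pi> t))"
      by (rule continuous_on_compose2[OF cont[OF that]]) (use \<pi> in blast)
    moreover have "norm (\<Phi> (apply_bcontfun \<phi>) (\<pi> t)) \<le> norm q\<^sub>a + R" for t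
    proof -
      have "norm (q\<^sub>a - \<Phi> (apply_bcontfun \<phi>) (\<pi> t)) \<le> R" using ball[OF that \<pi>[of t]] by (simp add: dist_norm)
      then show ?thesis using norm_triangle_ineq3[of q\<^sub>a "\<Phi> (apply_bcontfun \<phi>) (\<pi> t)"] by linarith
    qed
    ultimately have "(\<lambda>t. \<Phi> (apply_bcontfun \<phi>) (\<pi> t)) \<in> bcontfun" by (rule bcontfun_normI)
    then show ?thesis unfolding \<Psi>_def by (rule Bcontfun_inverse)
  qed
  have "\<exists>!\<phi>\<in>X. \<Psi> \<phi> = \<phi>"
  proof (rule Banach_fix)
    show "complete X" unfolding X_def complete_eq_closed by (intro closed_PiC) simp
    have "const_bcontfun q\<^sub>a \<in> X" using R(1) by (simp add: X_def mem_PiC_iff)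
    then show "X \<noteq> {}" by blast
    show "0 \<le> (1/2::real)" "(1/2::real) < 1" by simp_all
    show "\<Psi> ` X \<subseteq> X"
    proof
      fix \<psi> assume "\<psi> \<in> \<Psi> ` X"
      then obtain \<phi> where \<phi>: "\<phi> \<in> X" "\<psi> = \<Psi> \<phi>" by blast
      have "apply_bcontfun (\<Psi> \<phi>) t \<in> cball q\<^sub>a R" for t unfolding \<Psi>[OF \<phi>(1)] by (rule ball[OF \<phi>(1) \<pi>])
      then show "\<psi> \<in> X" unfolding \<phi>(2) X_def mem_PiC_iff by blast
    qed
    fix \<phi> \<psi> assume \<phi>: "\<phi> \<in> X" and \<psi>: "\<psi> \<in> X"
    let ?D = "dist \<phi> \<psi>"
    have D: "norm (apply_bcontfun \<phi> \<tau> - apply_bcontfun \<psi> \<tau>) \<le> ?D" for \<tau>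
      using dist_bounded[of \<phi> \<tau> \<psi>] by (simp add: dist_norm)
    show "dist (\<Psi> \<phi>) (\<Psi> \<psi>) \<le> 1/2 * ?D"
    proof (rule dist_bound)
      fix t0
      define t where "t = \<pi> t0"
      have t: "a \<le> a" "a \<le> t" "t \<le> b" using \<pi>[of t0] by (auto simp: t_def)
      have comp: "\<bar>(\<Phi> (apply_bcontfun \<phi>) t - \<Phi> (apply_bcontfun \<psi>) t) $ i\<bar> \<le> L * ?D * c" for i
      proof -
        \<comment> \<open>The difference estimate with T = a, where the agreement on [a, T) is
          vacuous.\<close>
        have "\<bar>RL_integral_raw a (\<alpha> $ i) (rhs (apply_bcontfun \<phi>) i) t - RL_integral_raw a (\<alpha> $ i) (rhs (apply_bcontfun \<psi>) i) t\<bar>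
          \<le> L * ?D * ((t - a) powr (\<alpha> $ i) / Gamma (\<alpha> $ i + 1))"
          by (rule RL_integral_rhs_diff_le[OF J sub continuous_on_apply_bcontfun X\<Omega>[OF \<phi>] bJ
                J sub continuous_on_apply_bcontfun X\<Omega>[OF \<psi>] bJ t _ X[OF \<phi>] X[OF \<psi>] R(3) Lb zero_le_dist D]) simp
        also have "\<dots> \<le> L * ?D * c"
          using h(2) t b(4) R(3) by (intro mult_left_mono) auto
        finally show ?thesis by (simp add: \<Phi>_def)
      qed
      have "norm (\<Phi> (apply_bcontfun \<phi>) t - \<Phi> (apply_bcontfun \<psi>) t)
          \<le> (\<Sum>i\<in>UNIV. \<bar>(\<Phi> (apply_bcontfun \<phi>) t - \<Phi> (apply_bcontfun \<psi>) t) $ i\<bar>)"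
        by (rule norm_le_l1_cart)
      also have "\<dots> \<le> (\<Sum>i\<in>(UNIV::'m set). L * ?D * c)" by (rule sum_mono) (rule comp)
      also have "\<dots> = ?m * (L * ?D * c)" by simp
      also have "\<dots> \<le> ?m * (L * ?D * (1 / (2 * (L + 1) * ?m)))"
        using R(3) m by (intro mult_left_mono) (auto simp: c_def)
      also have "\<dots> = (L / (L + 1)) * (1/2 * ?D)" using R(3) m by simp
      also have "\<dots> \<le> 1 * (1/2 * ?D)" using R(3) by (intro mult_right_mono) auto
      finally show "dist (apply_bcontfun (\<Psi> \<phi>) t0) (apply_bcontfun (\<Psi> \<psi>) t0) \<le> 1/2 * ?D"
        unfolding \<Psi>[OF \<phi>] \<Psi>[OF \<psi>] t_def by (simp add: dist_norm)
    qed
  qed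
  then obtain \<phi> where \<phi>: "\<phi> \<in> X" "\<Psi> \<phi> = \<phi>" by blast
  have fix_eq: "apply_bcontfun \<phi> t = \<Phi> (apply_bcontfun \<phi>) t" if "t \<in> {a..b}" for t
    using fun_cong[OF \<Psi>[OF \<phi>(1)], of t] \<pi>_id[OF that] by (simp add: \<phi>(2))
  have "apply_bcontfun \<phi> t $ i = q\<^sub>a $ i + RL_integral_raw a (\<alpha> $ i) (rhs (apply_bcontfun \<phi>) i) t" if "t \<in> {a..b}" for t i
    by (subst fix_eq[OF that]) (simp add: \<Phi>_def)
  then have "integral_solution (apply_bcontfun \<phi>) {a..b}"
    unfolding integral_solution_def using J sub continuous_on_apply_bcontfun X\<Omega>[OF \<phi>(1)] by blast
  then show ?thesis by blast
qed

section \<open>The greatest solution\<close>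

lemma ex_greatest_integral_solution:
  "\<exists>q I. integral_solution q I \<and> (\<forall>q' I'. integral_solution q' I' \<longrightarrow> I' \<subseteq> I \<and> (\<forall>t\<in>I'. q t = q' t))"
proof -
  define I where "I = \<Union>{I. \<exists>q. integral_solution q I}"
  \<comment> \<open>The value at t is borrowed from an arbitrary solution defined there; uniqueness
    makes it independent of the choice.\<close>
  define q where "q t = fst (SOME p. integral_solution (fst p) (snd p) \<and> t \<in> snd p) t" for t
  have q_eq: "q t = q' t" if "integral_solution q' I'" "t \<in> I'" for q' I' t
  proof -
    let ?p = "SOME p. integral_solution (fst p) (snd p) \<and> t \<in> snd p"
    have "integral_solution (fst ?p) (snd ?p) \<and> t \<in> snd ?p"
      by (rule someI[of _ "(q', I')"]) (use that in simp)
    then show ?thesis unfolding q_def using integral_solution_unique[OF _ that(1) _ that(2)] by blast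
  qed
  have I_sup: "I' \<subseteq> I" if "integral_solution q' I'" for q' I' unfolding I_def using that by blast
  have I_ex: "\<exists>q' I'. integral_solution q' I' \<and> t \<in> I'" if "t \<in> I" for t using that unfolding I_def by blast
  have Iff: "I' \<in> intervals_from a" "I' \<subseteq> I\<^sub>f" "continuous_on I' q'" "q' ` I' \<subseteq> \<Omega>"
    "\<forall>t\<in>I'. \<forall>i. q' t $ i = q\<^sub>a $ i + RL_integral_raw a (\<alpha> $ i) (rhs q' i) t"
    if "integral_solution q' I'" for q' I' using that unfolding integral_solution_def by auto
  have sub: "{a..t} \<subseteq> I'" if "integral_solution q' I'" "t \<in> I'" for q' I' t
    by (rule intervals_fromD(3)[OF Iff(1)[OF that(1)] intervals_fromD(1)[OF Iff(1)[OF that(1)]] that(2)])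
  have ge: "a \<le> t" if "t \<in> I" for t
    using I_ex[OF that] intervals_fromD(2)[OF Iff(1)] by blast
  obtain q0 I0 where s0: "integral_solution q0 I0" using ex_integral_solution by blast
  have II: "I \<in> intervals_from a"
    unfolding intervals_from_def
  proof (intro CollectI conjI)
    show "is_interval I"
      unfolding is_interval_1
    proof (intro ballI allI impI)
      fix x y z assume "x \<in> I" "y \<in> I" "x \<le> z \<and> z \<le> y"
      obtain q' I' where s: "integral_solution q' I'" "y \<in> I'" using I_ex[OF \<open>y \<in> I\<close>] by blast
      have "z \<in> {a..y}" using ge[OF \<open>x \<in> I\<close>] \<open>x \<le> z \<and> z \<le> y\<close> by simp
      then have "z \<in> I'" by (rule subsetD[OF sub[OF s]])
      then show "z \<in> I" by (rule subsetD[OF I_sup[OF s(1)]])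
    qed
    \<comment> \<open>Local existence is what makes I more than the point a.\<close>
    have "{a} \<subset> I0" using Iff(1)[OF s0] by (simp add: intervals_from_def)
    then show "{a} \<subset> I" using I_sup[OF s0] by (rule psubset_subset_trans)
    show "I \<subseteq> {a..}" using ge by (intro subsetI) simp
  qed
  have "integral_solution q I"
    unfolding integral_solution_def
  proof (intro conjI ballI allI)
    show "I \<in> intervals_from a" by (rule II)
    show "I \<subseteq> I\<^sub>f" using I_ex Iff(2) by blast
    show "continuous_on I q"
    proof (rule continuous_on_intervals_from[OF II])
      fix b assume "b \<in> I"
      then obtain q' I' where s: "integral_solution q' I'" "b \<in> I'" using I_ex by blast
      have "continuous_on {a..b} q'" by (rule continuous_on_subset[OF Iff(3)[OF s(1)] sub[OF s]])
      then show "continuous_on {a..b} q"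
        by (rule continuous_on_eq) (rule q_eq[OF s(1) subsetD[OF sub[OF s]], symmetric])
    qed
    show "q ` I \<subseteq> \<Omega>"
    proof (rule image_subsetI)
      fix t assume "t \<in> I"
      then obtain q' I' where s: "integral_solution q' I'" "t \<in> I'" using I_ex by blast
      then show "q t \<in> \<Omega>" using Iff(4)[OF s(1)] q_eq[OF s] by auto
    qed
    fix t i assume "t \<in> I"
    then obtain q' I' where s: "integral_solution q' I'" "t \<in> I'" using I_ex by blast
    have "q t $ i = q\<^sub>a $ i + RL_integral_raw a (\<alpha> $ i) (rhs q' i) t"
      using Iff(5)[OF s(1)] s(2) q_eq[OF s] by simp
    \<comment> \<open>The integral at t sees only [a, t], which lies inside I', where q and q'
      agree.\<close>
    also have "RL_integral_raw a (\<alpha> $ i) (rhs q' i) t = RL_integral_raw a (\<alpha> $ i) (rhs q i) t"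
    proof (rule RL_integral_raw_cong)
      fix \<tau> assume "\<tau> \<in> {a..t}"
      then have "\<tau> \<in> I'" by (rule subsetD[OF sub[OF s]])
      then show "rhs q' i \<tau> = rhs q i \<tau>" using q_eq[OF s(1)] by (simp add: rhs_def)
    qed (rule ge[OF \<open>t \<in> I\<close>])
    finally show "q t $ i = q\<^sub>a $ i + RL_integral_raw a (\<alpha> $ i) (rhs q i) t" .
  qed
  then show ?thesis using I_sup q_eq by (intro exI conjI allI impI ballI)
qed

end

theorem theorem2:
  fixes a :: real and I\<^sub>f :: "real set" and \<Omega> :: "(real ^ 'm) set"
    and f :: "real ^ 'm \<Rightarrow> real \<Rightarrow> real ^ 'm" and q\<^sub>a \<alpha> :: "real ^ 'm"
  assumes "I\<^sub>f \<in> intervals_from a"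
    and "open \<Omega>" and "\<Omega> \<noteq> {}"
    and "Caratheodory \<Omega> I\<^sub>f f"
    and "q\<^sub>a \<in> \<Omega>"
    and "\<And>i. 0 < \<alpha> $ i \<and> \<alpha> $ i \<le> 1"
    and "\<And>K c d. compact K \<Longrightarrow> K \<subseteq> \<Omega> \<Longrightarrow> {c..d} \<subseteq> I\<^sub>f \<Longrightarrow>
           \<exists>M\<ge>0. \<forall>x\<in>K. AE t in lebesgue_on {c..d}. norm (f x t) \<le> M"
    and "\<And>x t. x \<in> \<Omega> \<Longrightarrow> t \<in> I\<^sub>f \<Longrightarrow>
           \<exists>R>0. \<exists>\<delta>>0. \<exists>L\<ge>0. cball x R \<subseteq> \<Omega> \<and>
             (\<forall>x1\<in>cball x R. \<forall>x2\<in>cball x R.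
                AE \<tau> in lebesgue_on ({t - \<delta>..t + \<delta>} \<inter> I\<^sub>f).
                  norm (f x2 \<tau> - f x1 \<tau>) \<le> L * norm (x2 - x1))"
  shows "\<exists>q I. maximal_solution a I\<^sub>f \<Omega> f \<alpha> q\<^sub>a q I \<and>
           (\<forall>q' I'. maximal_solution a I\<^sub>f \<Omega> f \<alpha> q\<^sub>a q' I' \<longrightarrow> I' = I \<and> (\<forall>t\<in>I. q' t = q t)) \<and>
           (\<forall>q' I'. local_solution a I\<^sub>f \<Omega> f \<alpha> q\<^sub>a q' I' \<longrightarrow> is_extension a I\<^sub>f \<Omega> f \<alpha> q\<^sub>a q I q' I')"
proof -
  interpret Caputo_Cauchy_problem a I\<^sub>f \<Omega> f q\<^sub>a \<alpha>
    by unfold_locales (fact assms)+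
  obtain q I where s: "local_solution a I\<^sub>f \<Omega> f \<alpha> q\<^sub>a q I"
    and g: "\<forall>q' I'. local_solution a I\<^sub>f \<Omega> f \<alpha> q\<^sub>a q' I' \<longrightarrow> I' \<subseteq> I \<and> (\<forall>t\<in>I'. q t = q' t)"
    using ex_greatest_integral_solution unfolding local_solution_iff by blast
  have ext: "is_extension a I\<^sub>f \<Omega> f \<alpha> q\<^sub>a q I q' I'" if "local_solution a I\<^sub>f \<Omega> f \<alpha> q\<^sub>a q' I'" for q' I'
    unfolding is_extension_def using s g that by blast
  have "maximal_solution a I\<^sub>f \<Omega> f \<alpha> q\<^sub>a q I"
    unfolding maximal_solution_def is_extension_def using s g by blast
  \<comment> \<open>The greatest solution extends every maximal one, and maximality then forces
    equal intervals.\<close>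
  moreover have "I' = I \<and> (\<forall>t\<in>I. q' t = q t)" if "maximal_solution a I\<^sub>f \<Omega> f \<alpha> q\<^sub>a q' I'" for q' I'
  proof -
    have l: "local_solution a I\<^sub>f \<Omega> f \<alpha> q\<^sub>a q' I'" and "I = I'"
      using that ext unfolding maximal_solution_def by blast+
    then show ?thesis using g by simp
  qed
  ultimately show ?thesis using ext by blast
qed

end
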